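(* Let $X$ be a finite set of size $N$ and $Y=\{0,\dots,M-1\}$. Let $\mathcal P\subseteq (X\times Y)^k$ be a property for some $k\in\{1,\dots,M-1\}$, let $\epsilon\in\left(0,\,1-(9-4\sqrt2)\frac{k}{M}\right)$, and let $\mathsf F:Y^X\to 2^{\mathcal P}$ be the search problem induced by $\mathcal P$, i.e. $\mathsf F(f)$ is the set of all $((x_1,y_1),\dots,(x_k,y_k))\in\mathcal P$ with $f(x_i)=y_i$ for all $i$. Let $\mathsf{MLADV}^{\mathsf{Uniform}}_{\epsilon,\frac{2k}{M}}(\mathsf F)$ be the multiplicative ladder adversary bound with parameter $\eta=\frac{2k}{M}$ and uniform input distribution on $Y^X$, and let $\mathsf{COMP}^{\mathsf{Uniform}}_{\epsilon}(\mathsf F)$ be the compressed oracle bound (both defined in the context). Then $$\mathsf{COMP}^{\mathsf{Uniform}}_{\epsilon}(\mathsf F)\le 6\cdot \mathsf{MLADV}^{\mathsf{Uniform}}_{\epsilon,\frac{2k}{M}}(\mathsf F).$$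
   Context: Notation: $[n]=\{1,\dots,n\}$, $[n]_0=\{0,\dots,n\}$; $\mathbb C[S]$ is the Hilbert space with orthonormal basis $\{|s\rangle:s\in S\}$; $\|\cdot\|$ is the operator norm. Oracle. For $\mathsf{Func}\subseteq Y^X$, $x\in X$, $y\in Y$, $\mathcal O_{x,y}$ is the diagonal unitary on $\mathbb C[\mathsf{Func}]$ with $\mathcal O_{x,y}|f\rangle=e^{\frac{2\pi i}{M}y f(x)}|f\rangle$. In this statement $\mathsf{Func}=Y^X$, and we identify $|f\rangle=\bigotimes_{x\in X}|f(x)\rangle$, so $\mathbb C[Y^X]=\bigotimes_{x\in X}\mathbb C[Y]$. Reachable spaces. For a probability distribution $\delta$ on $\mathsf{Func}$ let $|\delta\rangle=\sum_f\sqrt{\delta(f)}|f\rangle$. For $t\in[N]$, $x_1,\dots,x_t\in X$, $y_1,\dots,y_t\in Y$ put $\alpha_{x_1,\dots,x_t}^{y_1,\dots,y_t}=\sum_{f\in\mathsf{Func}:\,f(x_i)=y_i\,\forall i}\delta(f)$ and, when this is nonzero, $|v_{x_1,\dots,x_t}^{y_1,\dots,y_t}\rangle=(\alpha_{x_1,\dots,x_t}^{y_1,\dots,y_t})^{-1/2}\sum_{f\in\mathsf{Func}:\,f(x_i)=y_i\,\forall i}\sqrt{\delta(f)}|f\rangle$. Let $\mathsf{Space}_0(\delta)=\mathrm{span}\{|\delta\rangle\}$, $\mathsf{Space}_t(\delta)=\mathrm{span}\{|v_{x_1,\dots,x_t}^{y_1,\dots,y_t}\rangle\}$ (over all $x_i\in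 X,y_i\in Y$) for $t\in[N]$, and $\mathsf{Space}_t(\delta)=\mathsf{Space}_N(\delta)$ for $t>N$. $\Pi_{\le t}$ is the orthogonal projector onto $\mathsf{Space}_t(\delta)$. MLA matrix. A multiplicative ladder adversary (MLA) matrix (with respect to $\delta$) is a positive definite matrix $\Gamma\in\mathbb C^{\mathsf{Func}\times\mathsf{Func}}$ with smallest eigenvalue $1$ whose spectral decomposition is $\Gamma=\sum_{i=0}^{\ell}\kappa^i\Lambda_i$ for some $\kappa>1$ ($\ell+1$ is the number of distinct eigenvalues, $\Lambda_i$ the projector onto the $\kappa^i$-eigenspace), such that $\Gamma$ commutes with $\Pi_{\le t}$ for all $t\in[N]_0$, and $\|\Lambda_{i'}\mathcal O_{x,y}\Lambda_i\|=0$ for all $x\in X$, $y\in Y$ and all $i,i'\in[\ell]_0$ with $|i'-i|>1$. MLADV bound. For a search problem $\mathsf F:\mathsf{Func}\to2^\Sigma$, a distribution $\delta$ on $\mathsf{Func}$, $\eta>0$ and $\epsilon\in(0,1-\eta)$, let $F_z=\sum_{f\in\mathsf{Func}:\,z\in\mathsf F(f)}|f\rangle\langle f|$ for $z\in\Sigma$. A pair $(\Gamma,\lambda)$ is admissible if $\Gamma=\sum_{i=0}^\ell\kappa^i\Lambda_i$ is an MLA matrix with $\Gamma|\delta\rangle=|\delta\rangle$, $1<\lambda\le\kappa^\ell$, and $\|F_z\Lambda_{\mathsf{bad}}\|^2\le\eta$ for all $z\in\Sigma$, where $\Lambda_{\mathsf{bad}}$ is the projector onto the eigenspaces of $\Gamma$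 with eigenvalue smaller than $\lambda$. $\mathsf{MLADV}^\delta_{\epsilon,\eta}(\mathsf F)$ is the smallest non-negative integer $T$ ($+\infty$ if none) such that for all admissible $(\Gamma,\lambda)$ $$1+(\lambda-1)(\sqrt{1-\epsilon}-\sqrt\eta)^2\le\prod_{t=1}^T\Big(1+\max_{i\in[\ell-1]_0,\,x\in X,\,y\in Y}\tfrac{\kappa-1}{\sqrt\kappa}\|\Lambda_{i+1}\Pi_{\le t}\mathcal O_{x,y}\Pi_{\le t-1}\Lambda_i\|\Big)^2 .$$ The superscript $\mathsf{Uniform}$ means that $\delta$ is the uniform distribution on $Y^X$. Compressed oracle bound. For $y\in Y$ let $|\hat y\rangle=\frac1{\sqrt M}\sum_{z\in Y}e^{\frac{2\pi i}{M}yz}|z\rangle$. Let $\mathsf{Comp}_x:\mathbb C[Y]\to\mathbb C[Y\cup\{\bot\}]$ be the isometry $|\bot\rangle\langle\hat0|+\sum_{z\in Y\setminus\{0\}}|\hat z\rangle\langle\hat z|$ and $\mathsf{Comp}=\bigotimes_{x\in X}\mathsf{Comp}_x$. Put $\mathsf{cO}_{x,y}=\mathsf{Comp}\,\mathcal O_{x,y}\,\mathsf{Comp}^\dagger$. Let $\mathcal D=(Y\cup\{\bot\})^X$ be the set of databases, $|D\rangle=\bigotimes_{x}|D(x)\rangle$ for $D\in\mathcal D$, $|D|=|\{x\in X:D(x)\ne\bot\}|$, $\mathcal D_{\le s}=\{D\in\mathcal D:|D|\le s\}$, and $\mathcal D_{\mathcal P}=\{D\in\mathcal D:\exists((x_1,y_1),\dots,(x_k,y_k))\in\mathcal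 P,\ D(x_i)=y_i\ \forall i\}$. For $A\subseteq\mathcal D$, $\mathsf P_A=\sum_{D\in A}|D\rangle\langle D|$. Then $\mathsf{COMP}^{\mathsf{Uniform}}_\epsilon(\mathsf F)$ is the smallest non-negative integer $T$ ($+\infty$ if none) such that $$\sqrt{1-\epsilon}-\sqrt{\tfrac kM}\le\sum_{t=1}^T\max_{x\in X,y\in Y}\big\|\mathsf P_{\mathcal D_{\le t}\cap\mathcal D_{\mathcal P}}\,\mathsf{cO}_{x,y}\,\mathsf P_{\mathcal D_{\le t-1}\setminus\mathcal D_{\mathcal P}}\big\|.$$
   Formalization: The formal theorem also assumes that F(f) is non-empty for at least one f in Y^X; without this (e.g. P empty, N=1, M=4, k=1, ε=1/10) COMP is infinite while MLADV is at most 1, so the stated inequality fails. *)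

theory Defs
  imports "HOL-Probability.Probability" "Berlekamp_Zassenhaus.Finite_Field"
begin

section \<open>Linear algebra on the Hilbert space with orthonormal basis a finite type\<close>

text \<open>
  The space $\mathbb C[S]$ is \<^typ>\<open>complex ^ 's\<close> with its Euclidean norm, where the finite type
  \<^typ>\<open>'s\<close> is the set $S$; the tensor product of the spaces $\mathbb C[Y]$ over $x \in X$ is
  \<^typ>\<open>complex ^ ('x \<Rightarrow> 'y)\<close>.  The complex span of a set of vectors is \<^const>\<open>vec.span\<close>.
\<close>

definition dagger :: "complex ^ 'n ^ 'm \<Rightarrow> complex ^ 'm ^ 'n" where
  "dagger A = (\<chi> i j. cnj (A $ j $ i))"

definition opnorm :: "complex ^ 'n::finite ^ 'm::finite \<Rightarrow> real" where
  "opnorm A = onorm ((*v) A)"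

definition outer :: "complex ^ 'm \<Rightarrow> complex ^ 'n \<Rightarrow> complex ^ 'n ^ 'm" where
  "outer u v = (\<chi> i j. u $ i * cnj (v $ j))"

definition basis_proj :: "'s set \<Rightarrow> complex ^ 's ^ 's" where
  "basis_proj A = (\<chi> i j. if i = j \<and> i \<in> A then 1 else 0)"

definition is_orth_projector :: "complex ^ 's::finite ^ 's \<Rightarrow> (complex ^ 's) set \<Rightarrow> bool" where
  "is_orth_projector P V \<longleftrightarrow> P ** P = P \<and> dagger P = P \<and> range ((*v) P) = V"

definition orth_projector :: "(complex ^ 's::finite) set \<Rightarrow> complex ^ 's ^ 's" where
  "orth_projector V = (THE P. is_orth_projector P V)"

definition eigenspace :: "complex ^ 's::finite ^ 's \<Rightarrow> complex \<Rightarrow> (complex ^ 's) set" where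
  "eigenspace A c = {v. A *v v = c *s v}"

definition eigenvalues :: "complex ^ 's::finite ^ 's \<Rightarrow> complex set" where
  "eigenvalues A = {c. \<exists>v. v \<noteq> 0 \<and> A *v v = c *s v}"

definition positive_definite :: "complex ^ 's::finite ^ 's \<Rightarrow> bool" where
  "positive_definite A \<longleftrightarrow>
     dagger A = A \<and> (\<forall>v. v \<noteq> 0 \<longrightarrow> 0 < Re (\<Sum>i\<in>UNIV. cnj (v $ i) * (A *v v) $ i))"

text \<open>The description defining \<^const>\<open>orth_projector\<close> denotes for every complex subspace.\<close>

lemma cinner_matrix_dagger:
  fixes A :: "complex ^ 'n::finite ^ 'm::finite"
  shows "(\<Sum>i\<in>UNIV. cnj (u $ i) * (A *v w) $ i) = (\<Sum>j\<in>UNIV. cnj ((dagger A *v u) $ j) * w $ j)"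
proof -
  have "(\<Sum>i\<in>UNIV. cnj (u $ i) * (A *v w) $ i)
      = (\<Sum>i\<in>UNIV. \<Sum>j\<in>UNIV. cnj (u $ i) * (A $ i $ j * w $ j))"
    by (simp add: matrix_vector_mult_def sum_distrib_left)
  also have "\<dots> = (\<Sum>j\<in>UNIV. \<Sum>i\<in>UNIV. cnj (u $ i) * (A $ i $ j * w $ j))"
    by (rule sum.swap)
  also have "\<dots> = (\<Sum>j\<in>UNIV. cnj ((dagger A *v u) $ j) * w $ j)"
    by (simp add: matrix_vector_mult_def dagger_def sum_distrib_left mult_ac)
  finally show ?thesis .
qed

lemma dagger_mult:
  fixes A :: "complex ^ 'n::finite ^ 'm::finite" and B :: "complex ^ 'p::finite ^ 'n"
  shows "dagger (A ** B) = dagger B ** dagger A"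
  by (simp add: dagger_def matrix_matrix_mult_def vec_eq_iff mult.commute)

lemma orth_projector_unique:
  assumes P: "is_orth_projector P V" and Q: "is_orth_projector Q V"
  shows "P = Q"
proof -
  have absorb: "A ** B = B" if A: "is_orth_projector A V" and B: "is_orth_projector B V" for A B
  proof -
    have "(A ** B) *v v = B *v v" for v
    proof -
      from A B have "B *v v \<in> range ((*v) A)" by (auto simp: is_orth_projector_def)
      then obtain w where "B *v v = A *v w" by auto
      with A show ?thesis
        by (simp add: matrix_vector_mul_assoc[symmetric] is_orth_projector_def)
           (metis matrix_vector_mul_assoc)
    qed
    then show ?thesis by (simp add: matrix_eq)
  qed
  have "dagger (P ** Q) = dagger Q" using absorb[OF P Q] by simp
  then have "Q ** P = Q" using P Q by (simp add: dagger_mult is_orth_projector_def)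
  with absorb[OF Q P] show ?thesis by simp
qed

lemma orth_projector_exists:
  assumes V: "vec.subspace V"
  shows "\<exists>P. is_orth_projector P V"
proof -
  define ip where "ip u w = (\<Sum>i\<in>UNIV. cnj (u $ i) * w $ i)" for u w :: "complex ^ 'a"
  have ip_add: "ip u (v + w) = ip u v + ip u w" "ip (v + w) u = ip v u + ip w u"
    and ip_scale: "ip u (c *s w) = c * ip u w" "ip (c *s w) u = cnj c * ip w u"
    and ip_diff: "ip u (v - w) = ip u v - ip u w" "ip (v - w) u = ip v u - ip w u"
    for u v w c
    by (simp_all add: ip_def algebra_simps sum.distrib sum_distrib_left sum_subtractf)
  have ip_cnj: "ip w u = cnj (ip u w)" for u w
    by (simp add: ip_def mult.commute)
  have ip_Re: "Re (ip u w) = u \<bullet> w" for u w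
    by (simp add: ip_def inner_vec_def inner_complex_def)
  have ip_self: "u = 0" if "ip u u = 0" for u
    using ip_Re[of u u] that by simp
  have scaleR: "c *\<^sub>R v = complex_of_real c *s v" for c and v :: "complex ^ 'a"
    unfolding vec_eq_iff vector_scaleR_component vector_smult_component by (simp add: scaleR_conv_of_real)
  have VR: "subspace V"
    using V by (auto simp: subspace_def vec.subspace_def scaleR)
  have ex: "\<exists>y\<in>V. \<forall>w\<in>V. ip w (x - y) = 0" for x
  proof -
    obtain y z where y: "y \<in> span V" and z: "\<And>w. w \<in> span V \<Longrightarrow> orthogonal z w" and x: "x = y + z"
      using orthogonal_subspace_decomp_exists[of V x] by metis
    have sp: "span V = V" using VR by (simp add: span_eq_iff)
    have "ip w (x - y) = 0" if w: "w \<in> V" for w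
    proof (rule complex_eqI)
      have "w \<bullet> z = 0" using z w sp by (metis orthogonal_def inner_commute)
      then show "Re (ip w (x - y)) = Re 0" using x by (simp add: ip_Re)
      have "\<i> *s w \<in> V" using V w by (auto simp: vec.subspace_def)
      then have "orthogonal z (\<i> *s w)" using z sp by metis
      then have "(\<i> *s w) \<bullet> z = 0" by (metis orthogonal_def inner_commute)
      then have "Re (ip (\<i> *s w) z) = 0" by (simp add: ip_Re)
      then show "Im (ip w (x - y)) = Im 0" using x by (simp add: ip_scale)
    qed
    with y sp show ?thesis by auto
  qed
  define p where "p x = (SOME y. y \<in> V \<and> (\<forall>w\<in>V. ip w (x - y) = 0))" for x
  have p: "p x \<in> V" "w \<in> V \<Longrightarrow> ip w (x - p x) = 0" for x w
    using someI_ex[of "\<lambda>y. y \<in> V \<and> (\<forall>w\<in>V. ip w (x - y) = 0)"] ex[of x]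
    unfolding p_def by blast+
  have uniq: "p x = y" if y: "y \<in> V" and o: "\<And>w. w \<in> V \<Longrightarrow> ip w (x - y) = 0" for x y
  proof -
    have d: "p x - y \<in> V" using V p(1) y by (rule vec.subspace_diff)
    have "ip (p x - y) (p x - y) = ip (p x - y) (x - y) - ip (p x - y) (x - p x)"
      by (simp add: ip_diff)
    also have "\<dots> = 0" using d p(2) o by simp
    finally have "p x - y = 0" by (rule ip_self)
    then show ?thesis by simp
  qed
  have p_add: "p (x + y) = p x + p y" for x y
  proof (rule uniq)
    show "p x + p y \<in> V" using V p(1) by (simp add: vec.subspace_add)
    fix w assume w: "w \<in> V"
    have "ip w (x + y - (p x + p y)) = ip w (x - p x) + ip w (y - p y)"
      by (simp add: ip_add ip_diff)
    then show "ip w (x + y - (p x + p y)) = 0" using p(2) w by simp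
  qed
  have p_scale: "p (c *s x) = c *s p x" for c x
  proof (rule uniq)
    show "c *s p x \<in> V" using V p(1) by (simp add: vec.subspace_scale)
    fix w assume w: "w \<in> V"
    have "ip w (c *s x - c *s p x) = c * ip w (x - p x)"
      by (simp add: ip_scale ip_diff algebra_simps)
    then show "ip w (c *s x - c *s p x) = 0" using p(2) w by simp
  qed
  have p_id: "p x = x" if "x \<in> V" for x
    using that by (intro uniq) (simp_all add: ip_def)
  have lin: "Vector_Spaces.linear (*s) (*s) p"
    by unfold_locales (simp_all add: p_add p_scale algebra_simps)
  define P where "P = matrix p"
  have Pv: "P *v v = p v" for v
    unfolding P_def using lin by (rule matrix_works)
  have "P ** P = P"
    by (simp add: matrix_eq matrix_vector_mul_assoc[symmetric] Pv p_id p(1))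
  moreover have "range ((*v) P) = V"
    by (auto simp: Pv p(1)) (metis p_id rangeI)
  moreover have "dagger P = P"
  proof -
    have sym: "ip u (p w) = ip (p u) w" for u w
    proof -
      have "ip (p w) (u - p u) = 0" using p by blast
      then have "ip (u - p u) (p w) = 0" using ip_cnj by (metis complex_cnj_zero)
      moreover have "ip (p u) (w - p w) = 0" using p by blast
      ultimately show ?thesis by (simp add: ip_diff)
    qed
    have "dagger P *v u = P *v u" for u
    proof -
      have "ip (dagger P *v u - p u) w = 0" for w
        using cinner_matrix_dagger[of u P w] sym[of u w]
        by (simp add: ip_diff Pv) (simp add: ip_def)
      then have "dagger P *v u - p u = 0" by (intro ip_self)
      then show ?thesis by (simp add: Pv)
    qed
    then show ?thesis by (simp add: matrix_eq)
  qed
  ultimately show ?thesis by (auto simp: is_orth_projector_def)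
qed

lemma orth_projector_correct:
  "vec.subspace V \<Longrightarrow> is_orth_projector (orth_projector V) V"
  unfolding orth_projector_def
  using orth_projector_exists orth_projector_unique by (metis theI)

lemma subspace_eigenspace: "vec.subspace (eigenspace A c)"
  by (auto simp: vec.subspace_def eigenspace_def vec.add vec.scale algebra_simps
      matrix_vector_right_distrib vector_scalar_commute)

section \<open>Oracle\<close>

text \<open>
  $Y = \{0,\dots,M-1\}$ is the type \<^typ>\<open>'m mod_ring\<close> with $M =$ \<^term>\<open>CARD('m)\<close>, and $X$ is the
  (nonempty finite) type \<^typ>\<open>'x\<close> with $N =$ \<^term>\<open>CARD('x)\<close>.
\<close>

definition phase :: "'m::finite mod_ring \<Rightarrow> 'm mod_ring \<Rightarrow> complex" where
  "phase y z = exp (2 * of_real pi * \<i> / of_nat CARD('m)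
                     * of_int (to_int_mod_ring y) * of_int (to_int_mod_ring z))"

definition phase_oracle ::
  "'x::finite \<Rightarrow> 'm::finite mod_ring \<Rightarrow> complex ^ ('x \<Rightarrow> 'm mod_ring) ^ ('x \<Rightarrow> 'm mod_ring)" where
  "phase_oracle x y = (\<chi> f g. if f = g then phase y (f x) else 0)"

section \<open>Reachable spaces\<close>

definition dist_state :: "('x::finite \<Rightarrow> 'y::finite) pmf \<Rightarrow> complex ^ ('x \<Rightarrow> 'y)" where
  "dist_state \<delta> = (\<chi> f. of_real (sqrt (pmf \<delta> f)))"

definition consistent :: "'x list \<Rightarrow> 'y list \<Rightarrow> ('x \<Rightarrow> 'y) set" where
  "consistent xs ys = {f. \<forall>i < length xs. f (xs ! i) = ys ! i}"

definition cond_weight :: "('x::finite \<Rightarrow> 'y::finite) pmf \<Rightarrow> 'x list \<Rightarrow> 'y list \<Rightarrow> real" where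
  "cond_weight \<delta> xs ys = (\<Sum>f\<in>consistent xs ys. pmf \<delta> f)"

definition cond_state ::
  "('x::finite \<Rightarrow> 'y::finite) pmf \<Rightarrow> 'x list \<Rightarrow> 'y list \<Rightarrow> complex ^ ('x \<Rightarrow> 'y)" where
  "cond_state \<delta> xs ys = (1 / sqrt (cond_weight \<delta> xs ys)) *\<^sub>R
     (\<chi> f. if f \<in> consistent xs ys then of_real (sqrt (pmf \<delta> f)) else 0)"

definition reach_space :: "('x::finite \<Rightarrow> 'y::finite) pmf \<Rightarrow> nat \<Rightarrow> (complex ^ ('x \<Rightarrow> 'y)) set" where
  "reach_space \<delta> t =
     (if t = 0 then vec.span {dist_state \<delta>}
      else vec.span {cond_state \<delta> xs ys | xs ys.
             length xs = min t CARD('x) \<and> length ys = min t CARD('x) \<and> cond_weight \<delta> xs ys \<noteq> 0})"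

definition reach_proj ::
  "('x::finite \<Rightarrow> 'y::finite) pmf \<Rightarrow> nat \<Rightarrow> complex ^ ('x \<Rightarrow> 'y) ^ ('x \<Rightarrow> 'y)" where
  "reach_proj \<delta> t = orth_projector (reach_space \<delta> t)"

section \<open>Multiplicative ladder adversary bound\<close>

definition ladder_proj ::
  "complex ^ 's::finite ^ 's \<Rightarrow> real \<Rightarrow> nat \<Rightarrow> complex ^ 's ^ 's" where
  "ladder_proj \<Gamma> \<kappa> i = orth_projector (eigenspace \<Gamma> (of_real (\<kappa> ^ i)))"

text \<open>
  The numbers \<^term>\<open>\<kappa>\<close> and \<^term>\<open>l\<close> are determined by \<^term>\<open>\<Gamma>\<close> unless \<^term>\<open>l = 0\<close>, in which
  case \<^term>\<open>\<Gamma>\<close> is the identity.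
\<close>

definition MLA_matrix ::
  "('x::finite \<Rightarrow> 'm::finite mod_ring) pmf
    \<Rightarrow> complex ^ ('x \<Rightarrow> 'm mod_ring) ^ ('x \<Rightarrow> 'm mod_ring) \<Rightarrow> real \<Rightarrow> nat \<Rightarrow> bool" where
  "MLA_matrix \<delta> \<Gamma> \<kappa> l \<longleftrightarrow>
     positive_definite \<Gamma> \<and>
     1 \<in> eigenvalues \<Gamma> \<and> (\<forall>c\<in>eigenvalues \<Gamma>. 1 \<le> Re c) \<and>
     1 < \<kappa> \<and> card (eigenvalues \<Gamma>) = l + 1 \<and>
     \<Gamma> = (\<Sum>i=0..l. \<kappa> ^ i *\<^sub>R ladder_proj \<Gamma> \<kappa> i) \<and>
     (\<forall>t\<in>{0..CARD('x)}. \<Gamma> ** reach_proj \<delta> t = reach_proj \<delta> t ** \<Gamma>) \<and>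
     (\<forall>x y. \<forall>i\<in>{0..l}. \<forall>i'\<in>{0..l}. \<bar>int i' - int i\<bar> > 1 \<longrightarrow>
        opnorm (ladder_proj \<Gamma> \<kappa> i' ** phase_oracle x y ** ladder_proj \<Gamma> \<kappa> i) = 0)"

definition bad_proj :: "complex ^ 's::finite ^ 's \<Rightarrow> real \<Rightarrow> complex ^ 's ^ 's" where
  "bad_proj \<Gamma> lam =
     orth_projector (vec.span (\<Union>c\<in>{c. of_real c \<in> eigenvalues \<Gamma> \<and> c < lam}. eigenspace \<Gamma> (of_real c)))"

definition solution_proj ::
  "(('x::finite \<Rightarrow> 'y::finite) \<Rightarrow> 'z set) \<Rightarrow> 'z \<Rightarrow> complex ^ ('x \<Rightarrow> 'y) ^ ('x \<Rightarrow> 'y)" where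
  "solution_proj F z = basis_proj {f. z \<in> F f}"

definition admissible ::
  "('x::finite \<Rightarrow> 'm::finite mod_ring) pmf \<Rightarrow> real \<Rightarrow> 'z set \<Rightarrow> (('x \<Rightarrow> 'm mod_ring) \<Rightarrow> 'z set)
    \<Rightarrow> complex ^ ('x \<Rightarrow> 'm mod_ring) ^ ('x \<Rightarrow> 'm mod_ring) \<Rightarrow> real \<Rightarrow> nat \<Rightarrow> real \<Rightarrow> bool" where
  "admissible \<delta> \<eta> \<Sigma> F \<Gamma> \<kappa> l lam \<longleftrightarrow>
     MLA_matrix \<delta> \<Gamma> \<kappa> l \<and> \<Gamma> *v dist_state \<delta> = dist_state \<delta> \<and>
     1 < lam \<and> lam \<le> \<kappa> ^ l \<and>
     (\<forall>z\<in>\<Sigma>. (opnorm (solution_proj F z ** bad_proj \<Gamma> lam))\<^sup>2 \<le> \<eta>)"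

definition MLADV ::
  "('x::finite \<Rightarrow> 'm::finite mod_ring) pmf \<Rightarrow> real \<Rightarrow> real \<Rightarrow> 'z set
    \<Rightarrow> (('x \<Rightarrow> 'm mod_ring) \<Rightarrow> 'z set) \<Rightarrow> enat" where
  "MLADV \<delta> \<epsilon> \<eta> \<Sigma> F = Inf (enat ` {T. \<forall>\<Gamma> \<kappa> l lam. admissible \<delta> \<eta> \<Sigma> F \<Gamma> \<kappa> l lam \<longrightarrow>
     1 + (lam - 1) * (sqrt (1 - \<epsilon>) - sqrt \<eta>)\<^sup>2 \<le>
     (\<Prod>t=1..T. (1 + (MAX (i, x, y) \<in> {0..l - 1} \<times> UNIV \<times> UNIV.
        (\<kappa> - 1) / sqrt \<kappa> *
        opnorm (ladder_proj \<Gamma> \<kappa> (i + 1) ** reach_proj \<delta> t ** phase_oracle x y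
                ** reach_proj \<delta> (t - 1) ** ladder_proj \<Gamma> \<kappa> i)))\<^sup>2)})"

section \<open>Compressed phase_oracle bound\<close>

text \<open>\<^const>\<open>None\<close> plays the role of $\bot$; a database is a function \<^typ>\<open>'x \<Rightarrow> 'm mod_ring option\<close>.\<close>

definition fourier :: "'m::finite mod_ring \<Rightarrow> complex ^ 'm mod_ring" where
  "fourier y = (\<chi> z. 1 / of_real (sqrt (real CARD('m))) * phase y z)"

definition embed_bot :: "complex ^ 'y \<Rightarrow> complex ^ 'y option" where
  "embed_bot v = (\<chi> a. case a of None \<Rightarrow> 0 | Some z \<Rightarrow> v $ z)"

definition comp1 :: "complex ^ ('m::finite mod_ring) ^ ('m mod_ring option)" where
  "comp1 = outer (axis None 1) (fourier 0)
         + (\<Sum>z\<in>UNIV - {0}. outer (embed_bot (fourier z)) (fourier z))"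

text \<open>The tensor power of \<^const>\<open>comp1\<close>, by its matrix entries.\<close>

definition Comp :: "complex ^ ('x::finite \<Rightarrow> 'm::finite mod_ring) ^ ('x \<Rightarrow> 'm mod_ring option)" where
  "Comp = (\<chi> D f. \<Prod>x\<in>UNIV. comp1 $ D x $ f x)"

definition comp_oracle :: "'x::finite \<Rightarrow> 'm::finite mod_ring
    \<Rightarrow> complex ^ ('x \<Rightarrow> 'm mod_ring option) ^ ('x \<Rightarrow> 'm mod_ring option)" where
  "comp_oracle x y = Comp ** phase_oracle x y ** dagger Comp"

definition db_size :: "('x::finite \<Rightarrow> 'y option) \<Rightarrow> nat" where
  "db_size D = card {x. D x \<noteq> None}"

definition db_le :: "nat \<Rightarrow> ('x::finite \<Rightarrow> 'y option) set" where
  "db_le s = {D. db_size D \<le> s}"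

definition db_prop :: "('x \<times> 'y) list set \<Rightarrow> ('x \<Rightarrow> 'y option) set" where
  "db_prop P = {D. \<exists>p\<in>P. \<forall>(x, y)\<in>set p. D x = Some y}"

definition COMP :: "real \<Rightarrow> nat \<Rightarrow> ('x::finite \<times> 'm::finite mod_ring) list set \<Rightarrow> enat" where
  "COMP \<epsilon> k P = Inf (enat ` {T. sqrt (1 - \<epsilon>) - sqrt (real k / real CARD('m)) \<le>
     (\<Sum>t=1..T. MAX (x, y) \<in> UNIV \<times> UNIV.
        opnorm (basis_proj (db_le t \<inter> db_prop P) ** comp_oracle x y
                ** basis_proj (db_le (t - 1) - db_prop P)))})"

text \<open>
  If no function has a solution, the two bounds are not comparable: \<^const>\<open>db_prop\<close> is empty, so
  \<^const>\<open>COMP\<close> is infinite for small error, whereas no solution projector constrains the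
  admissible pairs any more and \<^const>\<open>MLADV\<close> can be finite.
\<close>

definition property_search :: "('x \<times> 'y) list set \<Rightarrow> ('x \<Rightarrow> 'y) \<Rightarrow> ('x \<times> 'y) list set" where
  "property_search P f = {p \<in> P. \<forall>(x, y)\<in>set p. f x = y}"

end

theory Submission
  imports Defs
begin

text \<open>
  Let $C$ denote the isometry \<^const>\<open>Comp\<close>, so that $C^\dagger C = 1$ and $\Pi_{\le t}$ is the
  compression $C^\dagger P_{\le t} C$ of the projector on databases of size at most $t$.  Suppose that
  $T$ satisfies the adversary inequality for all admissible pairs, and let $a_t$ be the $t$-th summand
  of the compressed oracle bound; it increases with $t$.  The oracle query with $y = 0$ is idle, so
  $a_{T+1}$ dominates the norm of $P_A C C^\dagger P_{A'}$, where $A$ and $A'$ are the databases of size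
  at most $T$ inside and outside the property.  If this norm exceeds $1/5$, the summands
  $T+1, \dots, 6T$ already add up to at least $1$.

  Otherwise call a database marked if it has the property or more than $T$ entries, and let $K$ be the
  compression of the projector on the marked databases.  A unit eigenvector of $K$ with eigenvalue $c$
  inside the reachable space satisfies $c (1 - c) \le 1/25$, so that $c \le 2/25$ or $c \ge 23/25$.
  The matrix with eigenvalue $1$ on the low part of $K$ and $\kappa$ on its complement is then
  admissible, the ladder transitions exceed the $a_t$ at most by the factor $25/23$, and the choice
  $\kappa = 1 + 4/s^2$ with $s = \sqrt{1-\epsilon} - \sqrt{2k/M}$ turns the adversary inequality
  into $s \le 3 \sum_{t \le T} a_t$.  The bound on $\epsilon$ says that
  $\sqrt{1-\epsilon} - \sqrt{k/M} \le 2 s$.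
\<close>

section \<open>Hermitian matrices and projectors\<close>

definition cip :: "complex ^ 'n::finite \<Rightarrow> complex ^ 'n \<Rightarrow> complex" where
  "cip u w = (\<Sum>i\<in>UNIV. cnj (u $ i) * w $ i)"

lemma scaleR_eq_smult: "c *\<^sub>R (v :: complex ^ 'n) = of_real c *s v"
  unfolding vec_eq_iff vector_scaleR_component vector_smult_component
  by (simp add: scaleR_conv_of_real)

lemma cip_add: "cip u (v + w) = cip u v + cip u w" "cip (v + w) u = cip v u + cip w u"
  and cip_diff: "cip u (v - w) = cip u v - cip u w" "cip (v - w) u = cip v u - cip w u"
  and cip_smult: "cip u (c *s w) = c * cip u w" "cip (c *s w) u = cnj c * cip w u"
  and cip_zero [simp]: "cip u 0 = 0" "cip 0 u = 0"
  by (simp_all add: cip_def algebra_simps sum.distrib sum_distrib_left sum_subtractf)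

lemma cip_cnj: "cnj (cip u w) = cip w u"
  by (simp add: cip_def mult.commute)

lemma Re_cip: "Re (cip u w) = u \<bullet> w"
  by (simp add: cip_def inner_vec_def inner_complex_def)

lemma Re_cip_self: "Re (cip u u) = (norm u)\<^sup>2"
  by (simp add: Re_cip power2_norm_eq_inner)

lemma cip_self: "cip u u = of_real ((norm u)\<^sup>2)"
  by (rule complex_eqI) (use cip_cnj[of u u] in \<open>simp_all add: Re_cip_self complex_eq_iff del: of_real_power\<close>)

lemma cip_dagger: "cip u (A *v w) = cip (dagger A *v u) w"
  using cinner_matrix_dagger[of u A w] by (simp add: cip_def)

lemma dagger_dagger [simp]: "dagger (dagger A) = A"
  by (simp add: dagger_def vec_eq_iff)

lemma cip_dagger': "cip (A *v w) u = cip w (dagger A *v u)"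
  using cip_dagger[of w "dagger A" u] by simp

lemma norm_smult: "norm (c *s (v :: complex ^ 'n::finite)) = cmod c * norm v"
proof -
  have "(norm (c *s v))\<^sup>2 = Re (cip (c *s v) (c *s v))" by (simp add: Re_cip_self)
  also have "\<dots> = Re ((c * cnj c) * cip v v)" by (simp add: cip_smult mult_ac)
  also have "\<dots> = (cmod c * norm v)\<^sup>2"
    by (simp add: cip_self complex_norm_square[symmetric] power_mult_distrib del: of_real_power of_real_mult)
  finally show ?thesis by (rule power2_eq_imp_eq) auto
qed

lemma cip_Cauchy_Schwarz: "cmod (cip u w) \<le> norm u * norm w"
proof (cases "cip u w = 0")
  case False
  define c where "c = cnj (cip u w) / cmod (cip u w)"
  have c: "cmod c = 1" using False by (simp add: c_def norm_divide)
  have "c * cip u w = of_real (cmod (cip u w))"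
    using False complex_norm_square[of "cip u w"] by (simp add: c_def mult.commute power2_eq_square field_simps)
  then have "cmod (cip u w) = u \<bullet> (c *s w)" by (simp add: Re_cip[symmetric] cip_smult)
  also have "\<dots> \<le> norm u * norm (c *s w)" by (rule norm_cauchy_schwarz)
  finally show ?thesis using c by (simp add: norm_smult)
qed auto

lemma dagger_add: "dagger (A + B) = dagger A + dagger B"
  and dagger_diff: "dagger (A - B) = dagger A - dagger B"
  and dagger_scaleR: "dagger (r *\<^sub>R A) = r *\<^sub>R dagger A"
  and dagger_mat_1 [simp]: "dagger (mat 1) = mat 1"
  by (auto simp: dagger_def vec_eq_iff mat_def)

lemma scaleR_mult_vec: "(r *\<^sub>R (A :: complex ^ 'n::finite ^ 'm)) *v v = r *\<^sub>R (A *v v)"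
  by (simp add: vec_eq_iff matrix_vector_mult_def scaleR_sum_right)

lemma mult_vec_scaleR: "(A :: complex ^ 'n::finite ^ 'm) *v (r *\<^sub>R v) = r *\<^sub>R (A *v v)"
  by (simp add: vec_eq_iff matrix_vector_mult_def scaleR_sum_right)

lemma norm_opnorm: "norm (A *v x) \<le> opnorm A * norm x"
  unfolding opnorm_def by (rule onorm) simp

lemma opnorm_nonneg: "0 \<le> opnorm A"
  unfolding opnorm_def by (rule onorm_pos_le) simp

lemma opnorm_le: "(\<And>x. norm (A *v x) \<le> b * norm x) \<Longrightarrow> opnorm A \<le> b"
  unfolding opnorm_def by (rule onorm_le)

section \<open>Extremal eigenvectors and linear equations on invariant subspaces\<close>

lemma subspace_of_vec_subspace:
  assumes "vec.subspace (V :: (complex ^ 'n) set)" shows "subspace V"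
  using assms by (auto simp: subspace_def vec.subspace_def scaleR_eq_smult)

text \<open>A minimiser of the Rayleigh quotient on the unit sphere of \<open>W\<close> is an
  eigenvector; invariance of \<open>W\<close> keeps the residual \<open>K v - c v\<close> inside
  \<open>W\<close>. This extremal statement replaces a full diagonalisation in what follows.\<close>

lemma hermitian_min_eigenvector:
  fixes K :: "complex ^ 'n::finite ^ 'n"
  assumes K: "dagger K = K" and W: "vec.subspace W" and nz: "w0 \<in> W" "w0 \<noteq> 0"
    and inv: "\<And>w. w \<in> W \<Longrightarrow> K *v w \<in> W"
  obtains c :: real and v where "v \<in> W" "v \<noteq> 0" "K *v v = of_real c *s v"
    and "\<And>w. w \<in> W \<Longrightarrow> c * (norm w)\<^sup>2 \<le> Re (cip w (K *v w))"
proof -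
  let ?q = "\<lambda>w. Re (cip w (K *v w))"
  note sub = subspace_of_vec_subspace[OF W]
  have "compact (W \<inter> sphere 0 1)"
    using closed_subspace[OF sub] by (intro closed_Int_compact) auto
  moreover have "inverse (norm w0) *\<^sub>R w0 \<in> W \<inter> sphere 0 1"
    using nz sub by (auto simp: subspace_scale)
  moreover have "continuous_on (W \<inter> sphere 0 1) ?q"
    unfolding Re_cip
    by (intro continuous_intros linear_continuous_on) (simp_all add: linear_conv_bounded_linear)
  ultimately obtain v where "v \<in> W \<inter> sphere 0 1"
    and "\<forall>w \<in> W \<inter> sphere 0 1. ?q v \<le> ?q w"
    using continuous_attains_inf[of "W \<inter> sphere 0 1" ?q] by blast
  then have v: "v \<in> W" "norm v = 1"
    and min: "\<And>w. w \<in> W \<Longrightarrow> norm w = 1 \<Longrightarrow> ?q v \<le> ?q w"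
    by auto
  define c where "c = ?q v"
  have lower: "c * (norm w)\<^sup>2 \<le> ?q w" if w: "w \<in> W" for w
  proof (cases "w = 0")
    case False
    have "c \<le> ?q (inverse (norm w) *\<^sub>R w)"
      unfolding c_def using w False sub by (intro min) (auto simp: subspace_scale)
    also have "\<dots> = ?q w / (norm w)\<^sup>2"
      by (simp add: Re_cip mult_vec_scaleR power2_eq_square divide_inverse)
    finally show ?thesis using False by (simp add: pos_le_divide_eq)
  qed auto
  \<comment> \<open>Moving the minimiser along its residual changes the Rayleigh quotient to first order by \<open>\<bar>x\<bar>\<^sup>2\<close>.\<close>
  define x where "x = K *v v - c *\<^sub>R v"
  have xW: "x \<in> W" unfolding x_def using v inv sub by (intro subspace_diff subspace_scale) auto
  define D where "D = ?q x - c * (norm x)\<^sup>2"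
  have D: "D \<ge> 0" using lower[OF xW] by (simp add: D_def)
  have quad: "0 \<le> 2 * s * (norm x)\<^sup>2 + s\<^sup>2 * D" for s
  proof -
    have sym: "v \<bullet> (K *v x) = x \<bullet> (K *v v)"
      using arg_cong[OF cip_dagger[of v K x], of Re] K by (simp add: Re_cip inner_commute)
    have "v + s *\<^sub>R x \<in> W" using v xW sub by (intro subspace_add subspace_scale)
    from lower[OF this] have "0 \<le> ?q (v + s *\<^sub>R x) - c * (norm (v + s *\<^sub>R x))\<^sup>2" by simp
    also have "\<dots> = 2 * s * (x \<bullet> (K *v v) - c * (x \<bullet> v)) + s\<^sup>2 * D"
      using v(2) sym
      by (simp add: Re_cip D_def c_def power2_norm_eq_inner matrix_vector_right_distrib
          mult_vec_scaleR inner_add_left inner_add_right norm_eq_1)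
         (simp add: algebra_simps power2_eq_square inner_commute)
    also have "x \<bullet> (K *v v) - c * (x \<bullet> v) = (norm x)\<^sup>2"
      by (simp add: x_def power2_norm_eq_inner inner_diff_right)
    finally show ?thesis .
  qed
  have "x = 0"
  proof (rule ccontr)
    assume "x \<noteq> 0"
    then have X: "(norm x)\<^sup>2 > 0" by simp
    \<comment> \<open>A negative step short enough for the linear term to beat the quadratic one;
      \<open>D + 1\<close> instead of \<open>D\<close> keeps the denominator positive when
      \<open>D = 0\<close>.\<close>
    let ?s = "- (norm x)\<^sup>2 / (D + 1)"
    have "0 \<le> 2 * ?s * (norm x)\<^sup>2 + ?s\<^sup>2 * D" by (rule quad)
    also have "\<dots> = ((norm x)\<^sup>2)\<^sup>2 / (D + 1) * (D / (D + 1) - 2)"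
      by (simp add: divide_inverse power2_eq_square algebra_simps)
    also have "\<dots> < 0"
      using D X by (intro mult_pos_neg divide_pos_pos) (auto simp: field_simps)
    finally show False by simp
  qed
  then have "K *v v = of_real c *s v" by (simp add: x_def scaleR_eq_smult)
  then show ?thesis using that v lower by (metis norm_zero zero_neq_one)
qed

text \<open>By the extremal eigenvector, \<open>K\<close> is bounded below by \<gamma> on
  \<open>W\<close>, hence injective there and, by dimension, onto. The last conclusion concerns
  \<open>cip w u\<close> because for a compression \<open>K\<close> this is the squared norm of the
  projected part of \<open>Comp w\<close>, see \<open>Re_cip_compress\<close>.\<close>

lemma hermitian_solve:
  fixes K :: "complex ^ 'n::finite ^ 'n"
  assumes K: "dagger K = K" and W: "vec.subspace W" and inv: "\<And>w. w \<in> W \<Longrightarrow> K *v w \<in> W"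
    and \<gamma>: "0 < \<gamma>"
    and ev: "\<And>v c. v \<in> W \<Longrightarrow> v \<noteq> 0 \<Longrightarrow> K *v v = of_real c *s v \<Longrightarrow> \<gamma> \<le> c"
    and u: "u \<in> W"
  obtains w where "w \<in> W" "K *v w = u" "Re (cip w u) \<le> (norm u)\<^sup>2 / \<gamma>"
proof -
  note sub = subspace_of_vec_subspace[OF W]
  have lower: "\<gamma> * (norm w)\<^sup>2 \<le> Re (cip w (K *v w))" if w: "w \<in> W" for w
  proof (cases "w = 0")
    case False
    then obtain c v where "v \<in> W" "v \<noteq> 0" "K *v v = of_real c *s v"
      and c: "\<And>w. w \<in> W \<Longrightarrow> c * (norm w)\<^sup>2 \<le> Re (cip w (K *v w))"
      using hermitian_min_eigenvector[OF K W w _ inv] by metis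
    then have "\<gamma> \<le> c" using ev by blast
    then have "\<gamma> * (norm w)\<^sup>2 \<le> c * (norm w)\<^sup>2" by (simp add: mult_right_mono)
    with c[OF w] show ?thesis by simp
  qed auto
  have lin: "linear ((*v) K)" by simp
  have inj: "inj_on ((*v) K) W"
  proof (rule inj_onI)
    fix x y assume xy: "x \<in> W" "y \<in> W" "K *v x = K *v y"
    then have "x - y \<in> W" using sub by (simp add: subspace_diff)
    from lower[OF this] have "\<gamma> * (norm (x - y))\<^sup>2 \<le> 0"
      using xy by (simp add: matrix_vector_mult_diff_distrib)
    then show "x = y" using \<gamma> by (auto simp: mult_le_0_iff)
  qed
  have "(*v) K ` W = W"
  proof (rule subspace_dim_equal)
    show "subspace ((*v) K ` W)" using lin sub by (rule linear_subspace_image)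
    have "dim ((*v) K ` W) = dim W"
      using lin inj sub by (intro dim_image_eq) (simp_all add: span_eq_iff[THEN iffD2])
    then show "dim ((*v) K ` W) \<ge> dim W" by simp
  qed (use inv sub in auto)
  then obtain w where w: "w \<in> W" "K *v w = u" using u by (metis imageE)
  have r: "Re (cip w u) \<le> norm w * norm u"
    using cip_Cauchy_Schwarz[of w u] complex_Re_le_cmod[of "cip w u"] by linarith
  have "\<gamma> * (norm w)\<^sup>2 \<le> norm w * norm u" using lower[OF w(1)] w(2) r by simp
  then have "\<gamma> * norm w \<le> norm u"
    by (cases "w = 0") (auto simp: power2_eq_square mult.assoc[symmetric])
  then have "norm w \<le> norm u / \<gamma>" using \<gamma> by (simp add: field_simps)
  then have "norm w * norm u \<le> norm u / \<gamma> * norm u" by (rule mult_right_mono) simp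
  with r have "Re (cip w u) \<le> (norm u)\<^sup>2 / \<gamma>" by (simp add: power2_eq_square)
  with w that show ?thesis by blast
qed

section \<open>Orthogonal projectors as matrices\<close>

lemma is_orth_projectorD:
  assumes "is_orth_projector L V"
  shows "L *v x \<in> V" "x \<in> V \<Longrightarrow> L *v x = x" "L ** L = L" "dagger L = L" "L *v (L *v x) = L *v x"
    "cip (L *v x) y = cip x (L *v y)"
proof -
  have *: "L ** L = L" "dagger L = L" "range ((*v) L) = V"
    using assms by (auto simp: is_orth_projector_def)
  show "L *v x \<in> V" "L ** L = L" "dagger L = L" using * by auto
  show i: "L *v (L *v x) = L *v x" for x using * by (simp add: matrix_vector_mul_assoc)
  show "x \<in> V \<Longrightarrow> L *v x = x" using *(3) i by auto
  show "cip (L *v x) y = cip x (L *v y)" using cip_dagger'[of L x y] * by simp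
qed

lemma orth_projector_eq: "is_orth_projector L V \<Longrightarrow> orth_projector V = L"
  unfolding orth_projector_def using orth_projector_unique by blast

lemma norm_projector_le:
  assumes "L ** L = L" "dagger L = L"
  shows "norm (L *v x) \<le> norm x"
proof -
  have "(norm (L *v x))\<^sup>2 = Re (cip (L *v x) (L *v x))" by (simp add: Re_cip_self)
  also have "\<dots> = Re (cip x (L *v x))"
    by (simp add: cip_dagger' assms matrix_vector_mul_assoc)
  also have "\<dots> \<le> norm x * norm (L *v x)"
    using cip_Cauchy_Schwarz complex_Re_le_cmod order_trans by blast
  finally show ?thesis by (cases "L *v x = 0") (auto simp: power2_eq_square)
qed

text \<open>Invariance under \<open>A\<close> gives \<open>L A L = A L\<close>; invariance under the
  adjoint gives \<open>L A L = L A\<close> after taking daggers.\<close>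

lemma projector_commute:
  assumes L: "is_orth_projector L V"
    and A: "\<And>v. v \<in> V \<Longrightarrow> A *v v \<in> V" and A': "\<And>v. v \<in> V \<Longrightarrow> dagger A *v v \<in> V"
  shows "A ** L = L ** A"
proof -
  have *: "L ** (B ** L) = B ** L" if "\<And>v. v \<in> V \<Longrightarrow> B *v v \<in> V" for B
  proof -
    have "L *v (B *v (L *v x)) = B *v (L *v x)" for x
      using is_orth_projectorD(1,2)[OF L] that by blast
    then show ?thesis by (simp add: matrix_eq matrix_vector_mul_assoc matrix_mul_assoc)
  qed
  have "dagger (L ** (dagger A ** L)) = dagger (dagger A ** L)" using *[of "dagger A"] A' by simp
  then have "L ** A ** L = L ** A"
    by (simp add: dagger_mult is_orth_projectorD(4)[OF L])
  with *[of A] A show ?thesis by (simp add: matrix_mul_assoc)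
qed

section \<open>Two-level adversary matrices\<close>

text \<open>A ladder with a single rung, so that the restriction on transitions between levels at
  distance more than one is vacuous.\<close>

definition two_level :: "complex ^ 's::finite ^ 's \<Rightarrow> real \<Rightarrow> complex ^ 's ^ 's" where
  "two_level L \<kappa> = L + \<kappa> *\<^sub>R (mat 1 - L)"

lemma two_level_mult: "two_level L \<kappa> *v v = L *v v + of_real \<kappa> *s (v - L *v v)"
  by (simp add: two_level_def matrix_vector_mult_add_rdistrib scaleR_mult_vec
      matrix_vector_mult_diff_rdistrib scaleR_eq_smult)

lemma is_orth_projector_complement:
  assumes L: "is_orth_projector L V"
  shows "is_orth_projector (mat 1 - L) {v. L *v v = 0}"
  unfolding is_orth_projector_def
proof (intro conjI)
  show "(mat 1 - L) ** (mat 1 - L) = mat 1 - L"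
    by (simp add: matrix_eq matrix_vector_mul_assoc[symmetric] matrix_vector_mult_diff_rdistrib
        matrix_vector_mult_diff_distrib is_orth_projectorD[OF L])
  show "dagger (mat 1 - L) = mat 1 - L"
    by (simp add: dagger_diff is_orth_projectorD[OF L])
  show "range ((*v) (mat 1 - L)) = {v. L *v v = 0}"
  proof (intro equalityI subsetI)
    fix v assume "v \<in> {v. L *v v = 0}"
    then have "v = (mat 1 - L) *v v" by (simp add: matrix_vector_mult_diff_rdistrib)
    then show "v \<in> range ((*v) (mat 1 - L))" by (rule range_eqI)
  qed (auto simp: matrix_vector_mult_diff_rdistrib matrix_vector_mult_diff_distrib
      is_orth_projectorD[OF L])
qed

context
  fixes L :: "complex ^ 's::finite ^ 's" and V :: "(complex ^ 's) set" and \<kappa> :: real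
  assumes L: "is_orth_projector L V" and \<kappa>: "1 < \<kappa>"
begin

text \<open>Applying \<open>L\<close> to the eigenvalue equation gives
  \<open>(1 - c) L v = 0\<close>; subtracting this component leaves
  \<open>(\<kappa> - c) (v - L v) = 0\<close>. Eigenspaces and eigenvalues are both read off from
  the two disjunctions.\<close>

lemma two_level_eigen_iff:
  "two_level L \<kappa> *v v = c *s v \<longleftrightarrow>
     (c = 1 \<or> L *v v = 0) \<and> (c = of_real \<kappa> \<or> L *v v = v)"
proof
  assume e: "two_level L \<kappa> *v v = c *s v"
  have "L *v (two_level L \<kappa> *v v) = L *v (c *s v)" using e by simp
  then have 1: "L *v v = c *s (L *v v)"
    by (simp add: two_level_mult matrix_vector_right_distrib vector_scalar_commute
        matrix_vector_mult_diff_distrib is_orth_projectorD[OF L])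
  have D: "L *v v - c *s (L *v v) = 0" by (rule right_minus_eq[THEN iffD2, OF 1])
  have "(1 - c) *s (L *v v) = L *v v - c *s (L *v v)" by (simp add: vector_sub_rdistrib)
  also note D
  finally have "(1 - c) *s (L *v v) = 0" .
  then have A: "c = 1 \<or> L *v v = 0" by (simp only: vector_mul_eq_0) auto
  have "(of_real \<kappa> - c) *s (v - L *v v) = (two_level L \<kappa> *v v - c *s v) - (L *v v - c *s (L *v v))"
    by (simp add: two_level_mult vec_eq_iff algebra_simps)
  also have "\<dots> = 0" unfolding e D by simp
  finally have "c = of_real \<kappa> \<or> L *v v = v" by (simp only: vector_mul_eq_0) auto
  with A show "(c = 1 \<or> L *v v = 0) \<and> (c = of_real \<kappa> \<or> L *v v = v)" by blast
next
  assume "(c = 1 \<or> L *v v = 0) \<and> (c = of_real \<kappa> \<or> L *v v = v)"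
  then show "two_level L \<kappa> *v v = c *s v" by (auto simp: two_level_mult)
qed

lemma eigenspace_two_level:
  "eigenspace (two_level L \<kappa>) 1 = V" "eigenspace (two_level L \<kappa>) (of_real \<kappa>) = {v. L *v v = 0}"
proof -
  have "L *v v = v \<longleftrightarrow> v \<in> V" for v
    using is_orth_projectorD(1,2)[OF L] by metis
  then show "eigenspace (two_level L \<kappa>) 1 = V"
    "eigenspace (two_level L \<kappa>) (of_real \<kappa>) = {v. L *v v = 0}"
    unfolding eigenspace_def two_level_eigen_iff using \<kappa> by simp_all
qed

lemma ladder_proj_two_level:
  "ladder_proj (two_level L \<kappa>) \<kappa> 0 = L" "ladder_proj (two_level L \<kappa>) \<kappa> (Suc 0) = mat 1 - L"
  using eigenspace_two_level orth_projector_eq[OF L]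
    orth_projector_eq[OF is_orth_projector_complement[OF L]]
  by (simp_all add: ladder_proj_def)

context
  fixes v0 v1 :: "complex ^ 's"
  assumes v0: "v0 \<noteq> 0" "L *v v0 = v0" and v1: "v1 \<noteq> 0" "L *v v1 = 0"
begin

lemma eigenvalues_two_level: "eigenvalues (two_level L \<kappa>) = {1, of_real \<kappa>}"
proof (intro equalityI subsetI)
  fix c assume "c \<in> eigenvalues (two_level L \<kappa>)"
  then obtain v where "v \<noteq> 0" "(c = 1 \<or> L *v v = 0) \<and> (c = of_real \<kappa> \<or> L *v v = v)"
    unfolding eigenvalues_def two_level_eigen_iff by blast
  then show "c \<in> {1, of_real \<kappa>}" by auto
next
  fix c :: complex assume "c \<in> {1, of_real \<kappa>}"
  then show "c \<in> eigenvalues (two_level L \<kappa>)"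
    unfolding eigenvalues_def two_level_eigen_iff using v0 v1 by auto
qed

lemma bad_proj_two_level: "bad_proj (two_level L \<kappa>) \<kappa> = L"
proof -
  have "{c. complex_of_real c \<in> eigenvalues (two_level L \<kappa>) \<and> c < \<kappa>} = {1}"
    using \<kappa> by (auto simp: eigenvalues_two_level)
  moreover have "vec.subspace V"
    using eigenspace_two_level(1) subspace_eigenspace by metis
  ultimately show ?thesis
    using orth_projector_eq[OF L] by (simp add: bad_proj_def eigenspace_two_level vec.span_eq_iff[THEN iffD2])
qed

lemma positive_definite_two_level: "positive_definite (two_level L \<kappa>)"
  unfolding positive_definite_def
proof (intro conjI allI impI)
  show "dagger (two_level L \<kappa>) = two_level L \<kappa>"
    by (simp add: two_level_def dagger_add dagger_scaleR dagger_diff is_orth_projectorD[OF L])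
  fix v :: "complex ^ 's" assume v: "v \<noteq> 0"
  have "cip v (L *v v) = cip (L *v v) (L *v v)"
    using is_orth_projectorD(5,6)[OF L] by metis
  moreover have "norm (L *v v) \<le> norm v"
    by (rule norm_projector_le) (use is_orth_projectorD[OF L] in auto)
  then have "(norm (L *v v))\<^sup>2 \<le> (norm v)\<^sup>2" by simp
  moreover have "cip v (two_level L \<kappa> *v v) = cip v (L *v v) + of_real \<kappa> * (cip v v - cip v (L *v v))"
    by (simp add: two_level_mult cip_add cip_smult cip_diff algebra_simps)
  ultimately have "Re (cip v (two_level L \<kappa> *v v))
      = (norm (L *v v))\<^sup>2 + \<kappa> * ((norm v)\<^sup>2 - (norm (L *v v))\<^sup>2)"
    and le: "(norm (L *v v))\<^sup>2 \<le> (norm v)\<^sup>2"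
    by (simp_all add: cip_self del: of_real_power)
  moreover have "(norm v)\<^sup>2 - (norm (L *v v))\<^sup>2 \<le> \<kappa> * ((norm v)\<^sup>2 - (norm (L *v v))\<^sup>2)"
    using \<kappa> le mult_right_mono[of 1 \<kappa> "(norm v)\<^sup>2 - (norm (L *v v))\<^sup>2"] by simp
  moreover have "(norm v)\<^sup>2 > 0" using v by simp
  ultimately have "0 < Re (cip v (two_level L \<kappa> *v v))" by linarith
  then show "0 < Re (\<Sum>i\<in>UNIV. cnj (v $ i) * (two_level L \<kappa> *v v) $ i)" by (simp add: cip_def)
qed

end
end

text \<open>The threshold is \<kappa> itself, so the bad eigenspace is exactly \<open>V\<close>. A
  vector \<open>v1\<close> outside \<open>V\<close> guarantees that \<kappa> really occurs as an
  eigenvalue, so that there are exactly two levels.\<close>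

lemma admissible_two_level:
  fixes \<delta> :: "('x::finite \<Rightarrow> 'm::finite mod_ring) pmf"
  assumes L: "is_orth_projector L V" and \<kappa>: "1 < \<kappa>"
    and comm: "\<And>t. L ** reach_proj \<delta> t = reach_proj \<delta> t ** L"
    and \<delta>: "dist_state \<delta> \<in> V" "dist_state \<delta> \<noteq> 0"
    and v1: "v1 \<notin> V"
    and bad: "\<And>z. z \<in> \<Sigma> \<Longrightarrow> (opnorm (solution_proj F z ** L))\<^sup>2 \<le> \<eta>"
  shows "admissible \<delta> \<eta> \<Sigma> F (two_level L \<kappa>) \<kappa> 1 \<kappa>"
proof -
  note LD = is_orth_projectorD[OF L]
  have L\<delta>: "L *v dist_state \<delta> = dist_state \<delta>" using LD(2) \<delta> by blast
  \<comment> \<open>The component of \<open>v1\<close> orthogonal to \<open>V\<close> is the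
    eigenvector for \<kappa>.\<close>
  have w: "v1 - L *v v1 \<noteq> 0" "L *v (v1 - L *v v1) = 0"
    using v1 LD(1)[of v1] by (metis right_minus_eq, simp add: matrix_vector_mult_diff_distrib LD)
  note E = eigenvalues_two_level[OF L \<kappa> \<delta>(2) L\<delta> w]
  note la = ladder_proj_two_level[OF L \<kappa>]
  have "complex_of_real \<kappa> \<noteq> 1" using \<kappa> by (metis less_irrefl of_real_eq_1_iff)
  then have card: "card (eigenvalues (two_level L \<kappa>)) = 1 + 1" by (simp add: E)
  have "MLA_matrix \<delta> (two_level L \<kappa>) \<kappa> 1"
    unfolding MLA_matrix_def
  proof (intro conjI)
    show "positive_definite (two_level L \<kappa>)"
      by (rule positive_definite_two_level[OF L \<kappa> \<delta>(2) L\<delta> w])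
    show "two_level L \<kappa> = (\<Sum>i = 0..1. \<kappa> ^ i *\<^sub>R ladder_proj (two_level L \<kappa>) \<kappa> i)"
      by (simp add: la) (simp add: two_level_def)
    show "\<forall>t\<in>{0..CARD('x)}. two_level L \<kappa> ** reach_proj \<delta> t = reach_proj \<delta> t ** two_level L \<kappa>"
      using comm
      by (simp add: matrix_eq matrix_vector_mul_assoc[symmetric] two_level_mult
          matrix_vector_right_distrib matrix_vector_mult_diff_distrib vector_scalar_commute)
    show "\<forall>x y. \<forall>i\<in>{0..1}. \<forall>i'\<in>{0..1}. 1 < \<bar>int i' - int i\<bar> \<longrightarrow>
        opnorm (ladder_proj (two_level L \<kappa>) \<kappa> i' ** phase_oracle x y ** ladder_proj (two_level L \<kappa>) \<kappa> i) = 0"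
      by auto
  qed (use card \<kappa> in \<open>simp_all add: E\<close>)
  moreover have "two_level L \<kappa> *v dist_state \<delta> = dist_state \<delta>" by (simp add: two_level_mult L\<delta>)
  ultimately show ?thesis
    using bad \<kappa> by (simp add: admissible_def bad_proj_two_level[OF L \<kappa> \<delta>(2) L\<delta> w])
qed

section \<open>The compression isometry\<close>

text \<open>Site-dependent factors cover both the powers of \<open>comp1\<close> and patterns that
  constrain only some sites.\<close>

definition tensor :: "('x::finite \<Rightarrow> complex ^ 'b::finite ^ 'a::finite) \<Rightarrow> complex ^ ('x \<Rightarrow> 'b) ^ ('x \<Rightarrow> 'a)" where
  "tensor A = (\<chi> D f. \<Prod>x\<in>UNIV. A x $ D x $ f x)"

lemma prod_sum_UNIV:
  fixes g :: "'x::finite \<Rightarrow> 'b::finite \<Rightarrow> complex"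
  shows "(\<Sum>f\<in>UNIV. \<Prod>x\<in>UNIV. g x (f x)) = (\<Prod>x\<in>UNIV. \<Sum>z\<in>UNIV. g x z)"
  using prod_sum_PiE[of "UNIV :: 'x set" "\<lambda>_. UNIV" g] by simp

lemma tensor_mult:
  fixes A :: "'x::finite \<Rightarrow> complex ^ 'b::finite ^ 'a::finite" and B :: "'x \<Rightarrow> complex ^ 'c::finite ^ 'b"
  shows "tensor A ** tensor B = tensor (\<lambda>x. A x ** B x)"
  by (simp add: tensor_def matrix_matrix_mult_def vec_eq_iff prod.distrib[symmetric]
      prod_sum_UNIV[of "\<lambda>x z. A x $ _ x $ z * B x $ z $ _ x"])

lemma dagger_tensor: "dagger (tensor A) = tensor (\<lambda>x. dagger (A x))"
  by (simp add: tensor_def dagger_def vec_eq_iff)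

lemma tensor_scaleR: "tensor (\<lambda>x. c x *\<^sub>R A x) = (\<Prod>x\<in>UNIV. c x) *\<^sub>R tensor A"
  by (simp add: tensor_def vec_eq_iff) (simp add: scaleR_conv_of_real prod.distrib)

lemma basis_proj_UNIV: "basis_proj UNIV = mat 1"
  by (simp add: basis_proj_def mat_def)

lemma tensor_basis_proj:
  "tensor (\<lambda>x. basis_proj (A x)) = basis_proj {f. \<forall>x. f x \<in> A x}"
proof -
  have "tensor (\<lambda>x. basis_proj (A x)) $ f $ g = basis_proj {f. \<forall>x. f x \<in> A x} $ f $ g" for f g
  proof (cases "f = g \<and> (\<forall>x. f x \<in> A x)")
    case False
    then obtain x where "\<not> (f x = g x \<and> f x \<in> A x)" by (metis ext)
    then have "\<exists>x. basis_proj (A x) $ f x $ g x = (0 :: complex)"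
      by (intro exI[of _ x]) (simp add: basis_proj_def)
    then show ?thesis using False by (simp add: tensor_def) (auto simp: basis_proj_def)
  qed (simp add: tensor_def basis_proj_def)
  then show ?thesis by (simp add: vec_eq_iff)
qed

lemma tensor_mat_1: "tensor (\<lambda>x. mat 1) = mat 1"
  using tensor_basis_proj[of "\<lambda>_. UNIV"] by (simp add: basis_proj_UNIV)

section \<open>Diagonal projectors on basis states\<close>

lemma basis_proj_mult_nth: "(basis_proj A ** M) $ i $ j = (if i \<in> A then M $ i $ j else 0)"
  by (simp add: matrix_matrix_mult_def basis_proj_def mult_delta_left)

lemma mult_basis_proj_nth: "(M ** basis_proj A) $ i $ j = (if j \<in> A then M $ i $ j else 0)"
proof -
  have "(M ** basis_proj A) $ i $ j = (\<Sum>k\<in>UNIV. if k = j then if j \<in> A then M $ i $ j else 0 else 0)"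
    unfolding matrix_matrix_mult_def basis_proj_def vec_lambda_beta by (rule sum.cong) auto
  then show ?thesis by simp
qed

lemma basis_proj_vec_nth: "(basis_proj A *v v) $ i = (if i \<in> A then v $ i else 0)"
  by (simp add: matrix_vector_mult_def basis_proj_def mult_delta_left)

lemma dagger_basis_proj [simp]: "dagger (basis_proj A) = basis_proj A"
  by (auto simp: dagger_def basis_proj_def vec_eq_iff)

lemma basis_proj_idem [simp]: "basis_proj A ** basis_proj B = basis_proj (A \<inter> B)"
  by (auto simp: vec_eq_iff basis_proj_mult_nth) (auto simp: basis_proj_def)

lemma basis_proj_commute:
  assumes "\<And>i j. M $ i $ j \<noteq> 0 \<Longrightarrow> i \<in> A \<longleftrightarrow> j \<in> A"
  shows "M ** basis_proj A = basis_proj A ** M"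
  using assms by (auto simp: vec_eq_iff basis_proj_mult_nth mult_basis_proj_nth)

section \<open>Matrix entries of the one-site compression\<close>

lemma sum_phase:
  fixes w z :: "'m::finite mod_ring"
  shows "(\<Sum>y\<in>UNIV. phase y w * cnj (phase y z)) = (if w = z then of_nat CARD('m) else 0)"
proof -
  define d where "d = to_int_mod_ring w - to_int_mod_ring z"
  define M where "M = CARD('m)"
  have M: "M > 0" by (simp add: M_def)
  \<comment> \<open>The summands are powers of one root of unity, so the character sum becomes a
    geometric series over \<open>{..<M}\<close>.\<close>
  define \<omega> where "\<omega> = exp (2 * of_real pi * \<i> / of_nat M * of_int d)"
  have summand: "phase y w * cnj (phase y z) = \<omega> ^ nat (to_int_mod_ring y)" for y :: "'m mod_ring"
  proof -
    have "to_int_mod_ring y \<ge> 0"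
      using range_to_int_mod_ring[where ?'a = 'm] by (metis atLeastLessThan_iff rangeI)
    then have "\<omega> ^ nat (to_int_mod_ring y) = exp (of_int (to_int_mod_ring y) * (2 * of_real pi * \<i> / of_nat M * of_int d))"
      by (simp add: \<omega>_def exp_of_nat_mult[symmetric])
    then show ?thesis
      by (simp add: phase_def exp_cnj exp_add[symmetric] d_def M_def algebra_simps)
         (simp add: diff_divide_distrib)
  qed
  have inj: "inj (\<lambda>y :: 'm mod_ring. nat (to_int_mod_ring y))"
    using range_to_int_mod_ring[where ?'a = 'm]
    by (intro injI) (metis atLeastLessThan_iff eq_nat_nat_iff of_int_mod_ring_to_int_mod_ring rangeI)
  have "(\<lambda>y :: 'm mod_ring. nat (to_int_mod_ring y)) ` UNIV = nat ` range (to_int_mod_ring :: 'm mod_ring \<Rightarrow> int)"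
    by auto
  also have "\<dots> = {..<M}"
    unfolding range_to_int_mod_ring M_def
  proof (intro equalityI subsetI)
    fix n assume "n \<in> {..<CARD('m)}"
    then show "n \<in> nat ` {0..<int CARD('m)}" by (intro image_eqI[of _ _ "int n"]) auto
  qed auto
  finally have im: "(\<lambda>y :: 'm mod_ring. nat (to_int_mod_ring y)) ` UNIV = {..<M}" .
  have "(\<Sum>y\<in>UNIV. phase y w * cnj (phase y z)) = (\<Sum>n\<in>(\<lambda>y :: 'm mod_ring. nat (to_int_mod_ring y)) ` UNIV. \<omega> ^ n)"
    using inj by (simp add: summand sum.reindex)
  also have "\<dots> = (\<Sum>n<M. \<omega> ^ n)" by (simp only: im)
  also have "\<dots> = (if w = z then of_nat M else 0)"
  proof (cases "w = z")
    case False
    have "to_int_mod_ring w \<noteq> to_int_mod_ring z"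
      using False by (metis of_int_mod_ring_to_int_mod_ring)
    moreover have "0 \<le> to_int_mod_ring u" "to_int_mod_ring u < int M" for u :: "'m mod_ring"
      using range_to_int_mod_ring[where ?'a = 'm] unfolding M_def by (metis atLeastLessThan_iff rangeI)+
    ultimately have d: "d \<noteq> 0" "\<bar>d\<bar> < int M" unfolding d_def by (auto simp: abs_less_iff) (smt (verit))+
    \<comment> \<open>Otherwise \<open>M\<close> would divide \<open>d\<close>, which is nonzero and
      smaller than \<open>M\<close> in absolute value.\<close>
    have "\<omega> \<noteq> 1"
    proof
      assume "\<omega> = 1"
      then obtain n :: int where "2 * pi * real_of_int d / real M = of_int (2 * n) * pi"
        unfolding \<omega>_def exp_eq_1 by auto
      then have "real_of_int d = real_of_int n * real M" using M by (simp add: field_simps)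
      then have "d = n * int M" by (metis of_int_eq_iff of_int_mult of_int_of_nat_eq)
      with d show False by (auto simp: abs_mult)
    qed
    moreover have "\<omega> ^ M = 1"
    proof -
      have "\<omega> ^ M = exp (of_int d * (2 * of_real pi * \<i>))"
        using M by (simp add: \<omega>_def exp_of_nat_mult[symmetric] mult_ac)
      then show ?thesis using exp_integer_2pi[of "of_int d"] by (simp add: mult_ac)
    qed
    ultimately show ?thesis using False by (simp add: geometric_sum)
  qed (simp add: \<omega>_def d_def)
  finally show ?thesis by (simp add: M_def)
qed

lemma phase_0 [simp]: "phase 0 z = 1"
  by (simp add: phase_def)

lemma comp1_None: "(comp1 :: complex ^ ('m::finite mod_ring) ^ _) $ None $ z = of_real (1 / sqrt CARD('m))"
  by (simp add: comp1_def outer_def embed_bot_def fourier_def axis_def)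

text \<open>The projectors onto the nonzero Fourier vectors sum to the identity minus the projector
  onto the uniform vector, whose entries are all \<open>1 / CARD('m)\<close>.\<close>

lemma comp1_Some:
  fixes w :: "'m::finite mod_ring"
  shows "comp1 $ Some w $ z = of_real ((if w = z then 1 else 0) - 1 / CARD('m))"
proof -
  have "comp1 $ Some w $ z = (\<Sum>y\<in>UNIV - {0 :: 'm mod_ring}. fourier y $ w * cnj (fourier y $ z))"
    by (simp add: comp1_def outer_def embed_bot_def axis_def)
  also have "\<dots> = (\<Sum>y\<in>UNIV - {0 :: 'm mod_ring}. phase y w * cnj (phase y z) / of_nat CARD('m))"
  proof (rule sum.cong)
    have "complex_of_real (sqrt (real CARD('m))) * of_real (sqrt (real CARD('m))) = of_nat CARD('m)"
      by (simp flip: of_real_mult)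
    then show "fourier y $ w * cnj (fourier y $ z) = phase y w * cnj (phase y z) / of_nat CARD('m)" for y
      by (simp add: fourier_def)
  qed simp
  also have "\<dots> = ((\<Sum>y\<in>UNIV. phase y w * cnj (phase y z)) - 1) / of_nat CARD('m)"
    by (simp add: sum_divide_distrib[symmetric] sum_diff)
  also have "\<dots> = of_real ((if w = z then 1 else 0) - 1 / CARD('m))"
    unfolding sum_phase by (simp add: field_simps)
  finally show ?thesis .
qed

text \<open>The zero Fourier mode goes to \<open>None\<close>, so the other rows are orthogonal to
  constants. Hence \<open>Comp\<close> gives no weight to databases with an entry at a site on which
  the state does not depend.\<close>

lemma sum_comp1_Some: "(\<Sum>z\<in>UNIV. comp1 $ Some (w :: 'm::finite mod_ring) $ z) = 0"
proof -
  have "(\<Sum>z\<in>UNIV. comp1 $ Some w $ z) = of_real (\<Sum>z\<in>UNIV. (if w = z then 1 else 0) - 1 / CARD('m))"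
    by (simp only: comp1_Some of_real_sum)
  also have "(\<Sum>z\<in>UNIV. (if w = z then 1 else 0) - 1 / CARD('m)) = 0"
    by (simp add: sum_subtractf)
  finally show ?thesis by simp
qed

lemma dagger_comp1_comp1: "dagger comp1 ** comp1 = (mat 1 :: complex ^ ('m::finite mod_ring) ^ 'm mod_ring)"
proof -
  have "(dagger comp1 ** comp1) $ y $ z = (mat 1 :: complex ^ ('m mod_ring) ^ 'm mod_ring) $ y $ z" for y z
  proof -
    let ?M = "CARD('m)"
    let ?e = "\<lambda>w z :: 'm mod_ring. if w = z then 1 else (0 :: real)"
    have "(dagger comp1 ** comp1) $ y $ z
        = cnj (comp1 $ None $ y) * comp1 $ None $ z + (\<Sum>w\<in>UNIV. cnj (comp1 $ Some w $ y) * comp1 $ Some w $ z)"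
      by (simp add: matrix_matrix_mult_def dagger_def UNIV_option_conv sum.reindex)
    also have "\<dots> = of_real (1 / ?M + (\<Sum>w\<in>UNIV. (?e w y - 1 / ?M) * (?e w z - 1 / ?M)))"
      unfolding comp1_None comp1_Some complex_cnj_complex_of_real
        of_real_mult[symmetric] of_real_sum[symmetric] of_real_add[symmetric] by simp
    also have "(\<Sum>w\<in>UNIV. (?e w y - 1 / ?M) * (?e w z - 1 / ?M))
        = (\<Sum>w\<in>UNIV. (if w = y then ?e y z else 0) - ?e w z / ?M - ?e w y / ?M + 1 / ?M * (1 / ?M))"
      by (rule sum.cong) (auto simp: algebra_simps)
    also have "\<dots> = ?e y z - 1 / ?M"
      by (simp add: sum.distrib sum_subtractf sum_divide_distrib[symmetric])
    finally show ?thesis by (simp add: mat_def)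
  qed
  then show ?thesis by (simp add: vec_eq_iff)
qed

text \<open>The \<open>None\<close> row is constant and each \<open>Some\<close> row sums to zero.
  The range projector of the compression therefore neither creates nor removes an entry.\<close>

lemma comp1_dagger_comp1_mixed:
  fixes w :: "'m::finite mod_ring"
  shows "(comp1 ** dagger comp1) $ None $ Some w = 0" "(comp1 ** dagger comp1) $ Some w $ None = 0"
proof -
  have c: "cnj (comp1 $ a $ z) = comp1 $ a $ z" for a and z :: "'m mod_ring"
    by (cases a) (simp_all add: comp1_None comp1_Some)
  have "(comp1 ** dagger comp1) $ None $ Some w
      = of_real (1 / sqrt CARD('m)) * (\<Sum>z\<in>UNIV. comp1 $ Some w $ z)"
    by (simp only: matrix_matrix_mult_def dagger_def c comp1_None sum_distrib_left vec_lambda_beta)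
  then show "(comp1 ** dagger comp1) $ None $ Some w = 0" by (simp add: sum_comp1_Some)
  have "(comp1 ** dagger comp1) $ Some w $ None
      = (\<Sum>z\<in>UNIV. comp1 $ Some w $ z) * of_real (1 / sqrt CARD('m))"
    by (simp only: matrix_matrix_mult_def dagger_def c comp1_None sum_distrib_right vec_lambda_beta)
  then show "(comp1 ** dagger comp1) $ Some w $ None = 0" by (simp add: sum_comp1_Some)
qed

text \<open>The squared length of a \<open>Some\<close> row; it supplies the third factor of the
  cube in \<open>tensor_pattern\<close>.\<close>

lemma comp1_dagger_comp1_Some:
  fixes w :: "'m::finite mod_ring"
  shows "(comp1 ** dagger comp1) $ Some w $ Some w = of_real (1 - 1 / CARD('m))"
proof -
  let ?M = "CARD('m)"
  have "(comp1 ** dagger comp1) $ Some w $ Some w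
      = of_real (\<Sum>z\<in>UNIV. ((if w = z then 1 else 0) - 1 / ?M)\<^sup>2)"
    by (simp add: matrix_matrix_mult_def dagger_def comp1_Some power2_eq_square)
  also have "(\<Sum>z\<in>UNIV. ((if w = z then 1 else 0) - 1 / ?M)\<^sup>2)
     = (\<Sum>z\<in>UNIV. (if w = z then 1 - 2 / ?M else 0) + 1 / ?M * (1 / ?M))"
    by (rule sum.cong) (auto simp: power2_eq_square algebra_simps)
  also have "\<dots> = 1 - 1 / ?M" by (simp add: sum.distrib)
  finally show ?thesis .
qed

section \<open>The compression isometry on all sites\<close>

lemma Comp_eq_tensor: "Comp = tensor (\<lambda>_. comp1)"
  by (simp add: Comp_def tensor_def)

lemma dagger_Comp_Comp: "dagger Comp ** Comp = mat 1"
  by (simp add: Comp_eq_tensor dagger_tensor tensor_mult dagger_comp1_comp1 tensor_mat_1)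

lemma norm_Comp: "norm (Comp *v v) = norm v"
proof -
  have "(norm (Comp *v v))\<^sup>2 = (norm v)\<^sup>2"
    by (simp add: Re_cip_self[symmetric] cip_dagger matrix_vector_mul_assoc dagger_Comp_Comp)
  then show ?thesis by (simp add: power2_eq_iff_nonneg)
qed

text \<open>At no site does the range projector of \<open>Comp\<close> mix \<open>None\<close> with
  \<open>Some\<close>, so it preserves the set of filled sites and in particular its size. The link
  between reachable spaces and database sizes rests on this.\<close>

lemma Comp_dagger_Comp_commute:
  "(Comp ** dagger Comp) ** basis_proj (db_le t) = basis_proj (db_le t) ** (Comp ** dagger Comp)"
proof (rule basis_proj_commute)
  fix D D' :: "'a \<Rightarrow> 'b mod_ring option"
  assume "(Comp ** dagger Comp) $ D $ D' \<noteq> 0"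
  then have nz: "(comp1 ** dagger comp1) $ D x $ D' x \<noteq> 0" for x
    by (simp add: Comp_eq_tensor dagger_tensor tensor_mult) (simp add: tensor_def)
  have "D x = None \<longleftrightarrow> D' x = None" for x
    using nz[of x] by (cases "D x"; cases "D' x") (auto simp: comp1_dagger_comp1_mixed)
  then show "D \<in> db_le t \<longleftrightarrow> D' \<in> db_le t" by (simp add: db_le_def db_size_def del: not_None_eq)
qed

section \<open>Reachable spaces as compressions\<close>

definition reach_matrix :: "nat \<Rightarrow> complex ^ ('x::finite \<Rightarrow> 'm::finite mod_ring) ^ ('x \<Rightarrow> 'm mod_ring)" where
  "reach_matrix t = dagger Comp ** basis_proj (db_le t) ** Comp"

definition cond_indicator :: "'x list \<Rightarrow> 'y::finite list \<Rightarrow> complex ^ ('x::finite \<Rightarrow> 'y)" where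
  "cond_indicator xs ys = (\<chi> f. if f \<in> consistent xs ys then 1 else 0)"

lemma cond_state_uniform:
  fixes xs :: "'x::finite list" and ys :: "'y::finite list"
  defines "\<delta> \<equiv> pmf_of_set (UNIV :: ('x \<Rightarrow> 'y) set)"
  assumes "cond_weight \<delta> xs ys \<noteq> 0"
  obtains r :: real where "r \<noteq> 0" "cond_state \<delta> xs ys = r *\<^sub>R cond_indicator xs ys"
proof -
  define c where "c = 1 / real (CARD('x \<Rightarrow> 'y))"
  have c: "pmf \<delta> f = c" "c > 0" for f by (simp_all add: \<delta>_def c_def)
  have "(1 / sqrt (cond_weight \<delta> xs ys)) * sqrt c \<noteq> 0" using assms(2) c by simp
  moreover have "cond_state \<delta> xs ys = (1 / sqrt (cond_weight \<delta> xs ys) * sqrt c) *\<^sub>R cond_indicator xs ys"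
    by (simp add: vec_eq_iff cond_state_def cond_indicator_def c scaleR_eq_smult)
  ultimately show ?thesis using that by blast
qed

lemma cond_weight_uniform:
  fixes xs :: "'x::finite list" and ys :: "'y::finite list"
  shows "cond_weight (pmf_of_set (UNIV :: ('x \<Rightarrow> 'y) set)) xs ys \<noteq> 0 \<longleftrightarrow>
    (consistent xs ys :: ('x \<Rightarrow> 'y) set) \<noteq> {}"
  by (simp add: cond_weight_def)

lemma dist_state_uniform:
  obtains r :: real where "r \<noteq> 0"
    "dist_state (pmf_of_set (UNIV :: ('x::finite \<Rightarrow> 'y::finite) set)) = r *\<^sub>R cond_indicator [] []"
  by (rule that[of "sqrt (1 / real (CARD('x \<Rightarrow> 'y)))"])
    (simp_all add: dist_state_def cond_indicator_def consistent_def vec_eq_iff scaleR_eq_smult)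

text \<open>Dropping normalisation and admitting zero vectors does not change the spans. The case
  \<open>t = 0\<close> fits the same formula, since only empty lists qualify and they give the
  all-ones vector.\<close>

lemma reach_space_uniform:
  fixes t :: nat
  shows "reach_space (pmf_of_set (UNIV :: ('x::finite \<Rightarrow> 'y::finite) set)) t =
    vec.span {cond_indicator xs ys | xs ys. length xs = min t CARD('x) \<and> length ys = min t CARD('x)}"
    (is "?L = vec.span ?R")
proof (cases "t = 0")
  case True
  let ?d = "dist_state (pmf_of_set (UNIV :: ('x \<Rightarrow> 'y) set))"
  let ?i = "cond_indicator [] [] :: complex ^ ('x \<Rightarrow> 'y)"
  obtain r :: real where r: "r \<noteq> 0" "?d = r *\<^sub>R ?i" by (rule dist_state_uniform)
  have "?R = {?i}" using True by auto
  moreover have "vec.span {?d} = vec.span {?i}"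
  proof (rule vec.span_eq[THEN iffD2], intro conjI)
    show "{?d} \<subseteq> vec.span {?i}"
      using r by (simp add: scaleR_eq_smult vec.span_scale vec.span_base)
    have "?i = of_real (1 / r) *s ?d" using r by (simp add: scaleR_eq_smult vec_eq_iff)
    then have "?i \<in> vec.span {?d}" by (metis vec.span_scale vec.span_base singletonI)
    then show "{?i} \<subseteq> vec.span {?d}" by simp
  qed
  ultimately show ?thesis using True by (simp add: reach_space_def)
next
  case False
  let ?\<delta> = "pmf_of_set (UNIV :: ('x \<Rightarrow> 'y) set)"
  let ?S = "{cond_state ?\<delta> xs ys | xs ys.
             length xs = min t CARD('x) \<and> length ys = min t CARD('x) \<and> cond_weight ?\<delta> xs ys \<noteq> 0}"
  have "vec.span ?S = vec.span ?R"
  proof (rule vec.span_eq[THEN iffD2], intro conjI subsetI)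
    fix v assume "v \<in> ?S"
    then obtain xs ys where l: "length xs = min t CARD('x)" "length ys = min t CARD('x)"
      and w: "cond_weight ?\<delta> xs ys \<noteq> 0" and v: "v = cond_state ?\<delta> xs ys" by blast
    obtain r :: real where "v = r *\<^sub>R cond_indicator xs ys" using w v by (metis cond_state_uniform)
    moreover have "cond_indicator xs ys \<in> vec.span ?R" using l by (intro vec.span_base) blast
    ultimately show "v \<in> vec.span ?R" by (simp add: scaleR_eq_smult vec.span_scale)
  next
    fix v assume "v \<in> ?R"
    then obtain xs ys where l: "length xs = min t CARD('x)" "length ys = min t CARD('x)"
      and v: "v = cond_indicator xs ys" by blast
    show "v \<in> vec.span ?S"
    proof (cases "cond_weight ?\<delta> xs ys = 0")
      case True
      then have "v = 0" using cond_weight_uniform[of xs ys] by (simp add: v cond_indicator_def vec_eq_iff)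
      then show ?thesis by (simp add: vec.span_zero)
    next
      case False
      obtain r :: real where r: "r \<noteq> 0" "cond_state ?\<delta> xs ys = r *\<^sub>R cond_indicator xs ys"
        using False by (rule cond_state_uniform)
      then have "v = of_real (1 / r) *s cond_state ?\<delta> xs ys"
        by (simp add: v scaleR_eq_smult vec_eq_iff)
      moreover have "cond_state ?\<delta> xs ys \<in> vec.span ?S" using l False by (intro vec.span_base) blast
      ultimately show ?thesis by (simp add: vec.span_scale)
    qed
  qed
  with False show ?thesis by (simp add: reach_space_def)
qed

text \<open>The indicator factorises over the sites, and its factor at an unqueried site is
  constant, hence killed by a \<open>Some\<close> row.\<close>

lemma Comp_cond_indicator:
  assumes "D x = Some w" "x \<notin> set xs"
  shows "(Comp *v cond_indicator xs ys) $ D = 0"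
proof -
  \<comment> \<open>All constraints at one site are collected in one factor; a site listed with two
    different values makes it vanish, in accordance with an empty \<open>consistent\<close>
    set.\<close>
  define h where "h x z = (if \<forall>i<length xs. xs ! i = x \<longrightarrow> z = ys ! i then 1 else 0 :: complex)" for x z
  have ind: "cond_indicator xs ys $ f = (\<Prod>x\<in>UNIV. h x (f x))" for f
  proof (cases "f \<in> consistent xs ys")
    case False
    then obtain i where "i < length xs" "f (xs ! i) \<noteq> ys ! i" by (auto simp: consistent_def)
    then have "h (xs ! i) (f (xs ! i)) = 0" by (auto simp: h_def)
    then have "\<exists>x. h x (f x) = 0" by blast
    then show ?thesis using False by (simp add: cond_indicator_def)
  qed (auto simp: cond_indicator_def consistent_def h_def intro!: prod.neutral)
  have "(Comp *v cond_indicator xs ys) $ D = (\<Sum>f\<in>UNIV. \<Prod>x\<in>UNIV. comp1 $ D x $ f x * h x (f x))"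
    by (simp add: matrix_vector_mult_def Comp_def ind prod.distrib)
  also have "\<dots> = (\<Prod>x\<in>UNIV. \<Sum>z\<in>UNIV. comp1 $ D x $ z * h x z)"
    by (rule prod_sum_UNIV)
  also have "\<dots> = 0"
  proof -
    have "h x z = 1" for z using assms(2) by (auto simp: h_def)
    then have "(\<Sum>z\<in>UNIV. comp1 $ D x $ z * h x z) = 0"
      by (simp add: assms(1) sum_comp1_Some)
    then show ?thesis by auto
  qed
  finally show ?thesis .
qed

text \<open>Idempotence comes from the commutation of the range projector with the size cut-off. For
  the range, indicators on \<open>t\<close> queries compress to databases of size at most
  \<open>t\<close> and so are fixed; conversely, the columns of \<open>dagger Comp\<close> at such
  databases depend on at most \<open>t\<close> function values and so are combinations of
  indicators.\<close>

lemma is_orth_projector_reach_matrix: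
  fixes t :: nat
  shows "is_orth_projector (reach_matrix t)
    (reach_space (pmf_of_set (UNIV :: ('x::finite \<Rightarrow> 'm::finite mod_ring) set)) t)"
proof -
  let ?C = "Comp :: complex ^ ('x \<Rightarrow> 'm mod_ring) ^ ('x \<Rightarrow> 'm mod_ring option)"
  let ?P = "basis_proj (db_le t) :: complex ^ ('x \<Rightarrow> 'm mod_ring option) ^ _"
  let ?R = "reach_matrix t :: complex ^ ('x \<Rightarrow> 'm mod_ring) ^ ('x \<Rightarrow> 'm mod_ring)"
  let ?n = "min t CARD('x)"
  let ?B = "{cond_indicator xs ys | xs ys. length xs = ?n \<and> length ys = ?n} :: (complex ^ ('x \<Rightarrow> 'm mod_ring)) set"
  have "?R ** ?R = dagger ?C ** (?P ** (?C ** dagger ?C)) ** ?P ** ?C"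
    by (simp add: reach_matrix_def matrix_mul_assoc)
  also have "\<dots> = dagger ?C ** ((?C ** dagger ?C) ** ?P) ** ?P ** ?C"
    by (simp only: Comp_dagger_Comp_commute)
  also have "\<dots> = (dagger ?C ** ?C) ** dagger ?C ** (?P ** ?P) ** ?C"
    by (simp only: matrix_mul_assoc)
  also have "\<dots> = ?R" by (simp add: dagger_Comp_Comp reach_matrix_def)
  finally have idem: "?R ** ?R = ?R" .
  have herm: "dagger ?R = ?R"
    by (simp add: reach_matrix_def dagger_mult matrix_mul_assoc)
  have fixed: "?R *v v = v" if "v \<in> ?B" for v
  proof -
    from that obtain xs ys where l: "length xs = ?n" and v: "v = cond_indicator xs ys" by blast
    have "(?P *v (?C *v v)) $ D = (?C *v v) $ D" for D
    proof (cases "D \<in> db_le t")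
      case False
      have "\<not> {x. D x \<noteq> None} \<subseteq> set xs"
      proof
        assume "{x. D x \<noteq> None} \<subseteq> set xs"
        then have "card {x. D x \<noteq> None} \<le> card (set xs)" by (intro card_mono) auto
        also have "\<dots> \<le> t" using card_length[of xs] l by simp
        finally show False using False by (simp add: db_le_def db_size_def)
      qed
      then obtain x w where "D x = Some w" "x \<notin> set xs" by auto
      then show ?thesis using Comp_cond_indicator[of D x w xs ys] by (simp add: basis_proj_vec_nth v)
    qed (simp add: basis_proj_vec_nth)
    then have "?P *v (?C *v v) = ?C *v v" by (simp add: vec_eq_iff)
    then have "?R *v v = (dagger ?C ** ?C) *v v"
      by (simp add: reach_matrix_def matrix_vector_mul_assoc[symmetric])
    then show ?thesis by (simp add: dagger_Comp_Comp)
  qed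
  have col: "transpose (dagger ?C) $ D \<in> vec.span ?B" if D: "D \<in> db_le t" for D
  proof -
    let ?S = "{x. D x \<noteq> None}"
    have cS: "card ?S \<le> ?n"
      using D card_mono[of UNIV ?S] by (simp add: db_le_def db_size_def)
    obtain l where l: "set l = ?S" "distinct l" using finite_distinct_list[of ?S] by auto
    \<comment> \<open>The filled sites are padded to the exact length by repeating one of them; for
      the empty database any site will do, whence \<open>undefined\<close>.\<close>
    define xs where "xs = l @ replicate (?n - length l) (if l = [] then undefined else hd l)"
    have lxs: "length xs = ?n" using cS l distinct_card[of l] by (simp add: xs_def)
    have Sxs: "?S \<subseteq> set xs" using l by (auto simp: xs_def)
    let ?Ys = "(\<lambda>f. map f xs) ` (UNIV :: ('x \<Rightarrow> 'm mod_ring) set)"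
    let ?u = "transpose (dagger ?C) $ D"
    let ?g = "\<lambda>ys. SOME f :: 'x \<Rightarrow> 'm mod_ring. map f xs = ys"
    have u: "?u $ f = (\<Prod>x\<in>UNIV. cnj (comp1 $ D x $ f x))" for f
      by (simp add: transpose_def dagger_def Comp_def)
    \<comment> \<open>At sites outside \<open>xs\<close> the database is empty, and the
      \<open>None\<close> row is constant.\<close>
    have local: "?u $ f = ?u $ g" if "map f xs = map g xs" for f g
      unfolding u
    proof (rule prod.cong)
      fix x
      show "cnj (comp1 $ D x $ f x) = cnj (comp1 $ D x $ g x)"
        using that Sxs by (cases "D x") (auto simp: comp1_None)
    qed simp
    have cons: "f \<in> consistent xs ys \<longleftrightarrow> ys = map f xs" if "ys \<in> ?Ys" for f and ys :: "'m mod_ring list"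
      using that by (auto simp: consistent_def list_eq_iff_nth_eq)
    have g: "map (?g (map f xs)) xs = map f xs" for f
      by (rule someI[of "\<lambda>h. map h xs = map f xs" f]) simp
    have "?u = (\<Sum>ys\<in>?Ys. ?u $ ?g ys *s cond_indicator xs ys)"
    proof (rule vec_eq_iff[THEN iffD2], intro allI)
      fix f
      have "(\<Sum>ys\<in>?Ys. ?u $ ?g ys *s cond_indicator xs ys) $ f
          = (\<Sum>ys\<in>?Ys. if ys = map f xs then ?u $ ?g ys else 0)"
      proof -
        have "?u $ ?g ys * (if f \<in> consistent xs ys then 1 else 0) = (if ys = map f xs then ?u $ ?g ys else 0)"
          if "ys \<in> ?Ys" for ys
          by (simp only: cons[OF that]) simp
        then show ?thesis by (simp add: cond_indicator_def cong: sum.cong)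
      qed
      also have "\<dots> = ?u $ ?g (map f xs)" by (subst sum.delta) auto
      also have "\<dots> = ?u $ f" using local[OF g] .
      finally show "?u $ f = (\<Sum>ys\<in>?Ys. ?u $ ?g ys *s cond_indicator xs ys) $ f" by simp
    qed
    moreover have "\<dots> \<in> vec.span ?B"
    proof (intro vec.span_sum vec.span_scale vec.span_base)
      fix ys assume "ys \<in> ?Ys"
      then have "length ys = ?n" using lxs by auto
      with lxs show "cond_indicator xs ys \<in> ?B" by blast
    qed
    ultimately show ?thesis by simp
  qed
  have "range ((*v) ?R) = vec.span ?B"
  proof (intro equalityI subsetI)
    fix v assume "v \<in> range ((*v) ?R)"
    then obtain w where "v = ?R *v w" by blast
    then have "v = dagger ?C *v (?P *v (?C *v w))"
      by (simp add: reach_matrix_def matrix_vector_mul_assoc matrix_mul_assoc)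
    \<comment> \<open>Expansion into columns; the size cut-off kills the terms with a database
      outside \<open>db_le t\<close>.\<close>
    also have "\<dots> = (\<Sum>D\<in>UNIV. (?P *v (?C *v w)) $ D *s transpose (dagger ?C) $ D)"
      by (rule matrix_vector_column)
    also have "\<dots> \<in> vec.span ?B"
    proof (rule vec.span_sum)
      fix D show "(?P *v (?C *v w)) $ D *s transpose (dagger ?C) $ D \<in> vec.span ?B"
        using col[of D] by (cases "D \<in> db_le t") (simp_all add: basis_proj_vec_nth vec.span_zero vec.span_scale)
    qed
    finally show "v \<in> vec.span ?B" .
  next
    fix v assume v: "v \<in> vec.span ?B"
    have "vec.subspace {v. ?R *v v = v}"
      by (auto simp: vec.subspace_def matrix_vector_right_distrib vector_scalar_commute)
    then have "vec.span ?B \<subseteq> {v. ?R *v v = v}" using fixed by (intro vec.span_minimal) auto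
    then show "v \<in> range ((*v) ?R)" using v by (metis (mono_tags, lifting) mem_Collect_eq rangeI subsetD)
  qed
  with idem herm show ?thesis unfolding is_orth_projector_def reach_space_uniform by simp
qed

lemma reach_proj_uniform:
  "reach_proj (pmf_of_set (UNIV :: ('x::finite \<Rightarrow> 'm::finite mod_ring) set)) t = reach_matrix t"
  unfolding reach_proj_def by (rule orth_projector_eq[OF is_orth_projector_reach_matrix])

section \<open>The spectral gap\<close>

definition compress :: "('x::finite \<Rightarrow> 'm::finite mod_ring option) set
    \<Rightarrow> complex ^ ('x \<Rightarrow> 'm mod_ring) ^ ('x \<Rightarrow> 'm mod_ring)" where
  "compress A = dagger Comp ** basis_proj A ** Comp"

lemma reach_matrix_eq_compress: "reach_matrix t = compress (db_le t)"
  by (simp add: reach_matrix_def compress_def)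

lemma compress_vec: "compress A *v v = dagger Comp *v (basis_proj A *v (Comp *v v))"
  by (simp add: compress_def matrix_vector_mul_assoc matrix_mul_assoc)

lemma dagger_compress [simp]: "dagger (compress A) = compress A"
  by (simp add: compress_def dagger_mult matrix_mul_assoc)

lemma basis_proj_vec_idem [simp]: "basis_proj A *v (basis_proj B *v v) = basis_proj (A \<inter> B) *v v"
  by (simp add: matrix_vector_mul_assoc)

lemma cip_compress: "cip u (compress A *v v) = cip (basis_proj A *v (Comp *v u)) (basis_proj A *v (Comp *v v))"
  by (simp add: compress_vec cip_dagger)

lemma Re_cip_compress: "Re (cip v (compress A *v v)) = (norm (basis_proj A *v (Comp *v v)))\<^sup>2"
  by (simp only: cip_compress Re_cip_self)

lemma basis_proj_Compl: "basis_proj (- A) *v v = v - basis_proj A *v v"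
  by (simp add: vec_eq_iff basis_proj_vec_nth)

lemma dagger_Comp_Comp_vec [simp]: "dagger Comp *v (Comp *v v) = v"
  by (simp add: matrix_vector_mul_assoc dagger_Comp_Comp)

lemma compress_Compl: "compress (- A) *v v = v - compress A *v v"
  by (simp add: compress_vec basis_proj_Compl matrix_vector_mult_diff_distrib)

lemma Comp_dagger_Comp_commute_vec:
  "Comp *v (dagger Comp *v (basis_proj (db_le t) *v v)) = basis_proj (db_le t) *v (Comp *v (dagger Comp *v v))"
  using arg_cong[OF Comp_dagger_Comp_commute[of t], of "\<lambda>M. M *v v"]
  by (simp add: matrix_vector_mul_assoc[symmetric])

text \<open>The range projector between two diagonal projectors can be moved past a size cut-off and
  absorbed. The second equation is the adjoint of the first; together they show that every
  compression commutes with the reachable projectors.\<close>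

lemma compress_reach:
  "compress A *v (reach_matrix t *v v) = compress (A \<inter> db_le t) *v v"
  "reach_matrix t *v (compress A *v v) = compress (A \<inter> db_le t) *v v"
proof -
  show *: "compress A *v (reach_matrix t *v v) = compress (A \<inter> db_le t) *v v" for v :: "complex ^ ('a \<Rightarrow> 'b mod_ring)"
    by (simp add: reach_matrix_eq_compress compress_vec Comp_dagger_Comp_commute_vec)
  have "compress A ** reach_matrix t = (compress (A \<inter> db_le t) :: complex ^ ('a \<Rightarrow> 'b mod_ring) ^ _)"
    using * by (simp add: matrix_eq matrix_vector_mul_assoc[symmetric])
  then have "dagger (compress A ** reach_matrix t) = (compress (A \<inter> db_le t) :: complex ^ ('a \<Rightarrow> 'b mod_ring) ^ _)"
    by simp
  then have "reach_matrix t ** compress A = (compress (A \<inter> db_le t) :: complex ^ ('a \<Rightarrow> 'b mod_ring) ^ _)"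
    by (simp add: dagger_mult reach_matrix_eq_compress)
  then show "reach_matrix t *v (compress A *v v) = compress (A \<inter> db_le t) *v v"
    by (simp add: matrix_vector_mul_assoc)
qed

lemma reach_supported:
  assumes "reach_matrix t *v v = v"
  shows "basis_proj (db_le t) *v (Comp *v v) = Comp *v v"
proof -
  have "Comp *v v = Comp *v (reach_matrix t *v v)" using assms by simp
  also have "\<dots> = basis_proj (db_le t) *v (Comp *v v)"
    by (simp add: reach_matrix_eq_compress compress_vec Comp_dagger_Comp_commute_vec)
  finally show ?thesis by simp
qed

section \<open>The low part of the spectrum\<close>

lemma subspace_fixed: "vec.subspace {v. M *v v = (v :: complex ^ 'n::finite)}"
  by (auto simp: vec.subspace_def matrix_vector_right_distrib vector_scalar_commute)

text \<open>The cut at 1/2 lies inside the gap between 2/25 and 23/25 that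
  \<open>spectral_gap\<close> establishes for \<open>marked_op\<close> on the reachable
  space.\<close>

definition low_space :: "complex ^ 'n::finite ^ 'n \<Rightarrow> (complex ^ 'n) set" where
  "low_space K = vec.span {v. \<exists>c::real. c < 1 / 2 \<and> K *v v = of_real c *s v}"

lemma subspace_low_space: "vec.subspace (low_space K)"
  by (simp add: low_space_def)

lemma low_space_commuting:
  assumes "B ** K = K ** B" "v \<in> low_space K"
  shows "B *v v \<in> low_space K"
proof -
  let ?E = "{v. \<exists>c::real. c < 1 / 2 \<and> K *v v = of_real c *s v}"
  have "?E \<subseteq> {v. B *v v \<in> low_space K}"
  proof
    fix v assume "v \<in> ?E"
    then obtain c :: real where c: "c < 1 / 2" "K *v v = of_real c *s v" by blast
    have "K *v (B *v v) = B *v (K *v v)" using assms(1) by (simp add: matrix_vector_mul_assoc)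
    also have "\<dots> = of_real c *s (B *v v)" by (simp add: c vector_scalar_commute)
    finally have "B *v v \<in> ?E" using c by blast
    then show "v \<in> {v. B *v v \<in> low_space K}" by (simp add: low_space_def vec.span_base)
  qed
  moreover have "vec.subspace {v. B *v v \<in> low_space K}"
    using subspace_low_space[of K]
    by (auto simp: vec.subspace_def matrix_vector_right_distrib vector_scalar_commute)
  ultimately have "vec.span ?E \<subseteq> {v. B *v v \<in> low_space K}" by (rule vec.span_minimal)
  then show ?thesis using assms(2) by (auto simp: low_space_def)
qed

text \<open>Eigenvectors of a Hermitian matrix for different eigenvalues are orthogonal, so an
  eigenvector with \<open>c \<ge> 1 / 2\<close> would be orthogonal to the whole low space, itself
  included.\<close>

lemma low_space_eigenvalue:
  assumes K: "dagger K = K" and v: "v \<in> low_space K" "v \<noteq> 0" "K *v v = of_real c *s v"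
  shows "c < 1 / 2"
proof (rule ccontr)
  assume c: "\<not> c < 1 / 2"
  have "{v. \<exists>c::real. c < 1 / 2 \<and> K *v v = of_real c *s v} \<subseteq> {x. cip v x = 0}"
  proof clarify
    fix x and d :: real assume d: "d < 1 / 2" "K *v x = of_real d *s x"
    have "of_real d * cip v x = of_real c * cip v x"
      using cip_dagger[of v K x] by (simp add: K v d cip_smult)
    with c d show "cip v x = 0" by auto
  qed
  moreover have "vec.subspace {x. cip v x = 0}"
    by (auto simp: vec.subspace_def cip_add cip_smult)
  ultimately have "low_space K \<subseteq> {x. cip v x = 0}"
    unfolding low_space_def by (rule vec.span_minimal)
  then have "Re (cip v v) = 0" using v by auto
  with v show False by (simp add: Re_cip_self)
qed

lemma reach_matrix_projector:
  "reach_matrix t ** reach_matrix t = (reach_matrix t :: complex ^ ('x::finite \<Rightarrow> 'm::finite mod_ring) ^ _)"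
  "dagger (reach_matrix t) = (reach_matrix t :: complex ^ ('x \<Rightarrow> 'm mod_ring) ^ _)"
  "reach_matrix t *v (reach_matrix t *v v) = reach_matrix t *v (v :: complex ^ ('x \<Rightarrow> 'm mod_ring))"
  using is_orth_projectorD(3,4,5)[OF is_orth_projector_reach_matrix] by blast+

context
  fixes P :: "('x::finite \<times> 'm::finite mod_ring) list set" and T :: nat
begin

text \<open>Marking the oversized databases forces the low space into the reachable space for
  \<open>T\<close>, while up to size \<open>T\<close> being marked still means having the
  property.\<close>

definition marked :: "('x \<Rightarrow> 'm mod_ring option) set" where
  "marked = db_prop P \<union> - db_le T"

abbreviation "marked_op \<equiv> compress marked"

abbreviation "low_proj \<equiv> orth_projector (low_space marked_op)"

lemma is_orth_projector_low_proj: "is_orth_projector low_proj (low_space marked_op)"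
  by (rule orth_projector_correct[OF subspace_low_space])

lemma reach_marked_op: "reach_matrix t *v (marked_op *v v) = marked_op *v (reach_matrix t *v v)"
  by (simp only: compress_reach)

lemma reach_low_space: "v \<in> low_space marked_op \<Longrightarrow> reach_matrix t *v v \<in> low_space marked_op"
  by (rule low_space_commuting) (simp add: matrix_eq matrix_vector_mul_assoc[symmetric] reach_marked_op)

lemma low_proj_reach: "reach_matrix t ** low_proj = low_proj ** reach_matrix t"
  by (rule projector_commute[OF is_orth_projector_low_proj]) (simp_all add: reach_low_space reach_matrix_projector)

lemma low_proj_reach_vec: "low_proj *v (reach_matrix t *v v) = reach_matrix t *v (low_proj *v v)"
  using low_proj_reach[of t] by (simp add: matrix_vector_mul_assoc)

lemma low_proj_marked_op: "low_proj *v (marked_op *v v) = marked_op *v (low_proj *v v)"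
  using projector_commute[OF is_orth_projector_low_proj, of marked_op] low_space_commuting[of marked_op marked_op]
  by (simp add: matrix_vector_mul_assoc)

lemma low_space_reach:
  assumes "v \<in> low_space marked_op" shows "reach_matrix T *v v = v"
proof -
  have "{v. \<exists>c::real. c < 1 / 2 \<and> marked_op *v v = of_real c *s v} \<subseteq> {v. reach_matrix T *v v = v}"
  proof clarify
    fix v and c :: real assume c: "c < 1 / 2" "marked_op *v v = of_real c *s v"
    \<comment> \<open>Databases with more than \<^term>\<open>T\<close> entries are marked, so the part of \<^term>\<open>v\<close> outside the
      reachable space has eigenvalue 1.\<close>
    let ?x = "v - reach_matrix T *v v"
    have "marked_op *v ?x = compress (- (- marked)) *v v - compress (marked \<inter> db_le T) *v v"
      by (simp add: matrix_vector_mult_diff_distrib compress_reach)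
    also have "\<dots> = compress (- db_le T) *v v"
    proof -
      have "basis_proj marked *v w - basis_proj (marked \<inter> db_le T) *v w = basis_proj (- db_le T) *v w" for w
        by (auto simp: vec_eq_iff basis_proj_vec_nth marked_def)
      from arg_cong[OF this, of "(*v) (dagger Comp)" "Comp *v v"] show ?thesis
        by (simp add: compress_vec matrix_vector_mult_diff_distrib)
    qed
    also have "\<dots> = ?x" by (simp add: compress_Compl reach_matrix_eq_compress)
    finally have 1: "marked_op *v ?x = ?x" .
    have "marked_op *v ?x = of_real c *s ?x"
      by (simp add: matrix_vector_mult_diff_distrib reach_marked_op[symmetric] c vector_scalar_commute)
    then have "(1 - of_real c) *s ?x = 0"
      unfolding 1 by (metis diff_self vector_sub_rdistrib vector_smult_lid)
    then have "1 - complex_of_real c = 0 \<or> ?x = 0" by (simp only: vector_mul_eq_0)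
    moreover have "1 - complex_of_real c = of_real (1 - c)" by simp
    ultimately have "?x = 0" using c(1) by (auto simp del: of_real_diff)
    then show "reach_matrix T *v v = v" by simp
  qed
  then have "low_space marked_op \<subseteq> {v. reach_matrix T *v v = v}"
    unfolding low_space_def by (rule vec.span_minimal[OF _ subspace_fixed])
  then show ?thesis using assms by auto
qed

section \<open>Consequences of a small idle transition\<close>

context
  assumes gap: "opnorm (basis_proj (db_le T \<inter> db_prop P) ** (Comp ** dagger Comp)
     ** basis_proj (db_le T - db_prop P)) \<le> 1 / 5"
begin

text \<open>The marked and unmarked parts of \<open>Comp v\<close> have squared norms
  \<open>c\<close> and \<open>1 - c\<close> relative to that of \<open>v\<close>. The range
  projector sends the unmarked part to \<open>(1 - c) Comp v\<close>, whose marked part is what the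
  idle transition in \<open>gap\<close> produces. This gives \<open>c = 1\<close> or
  \<open>c (1 - c) \<le> 1/25\<close>.\<close>

lemma spectral_gap:
  assumes v: "v \<noteq> 0" "marked_op *v v = of_real c *s v" "reach_matrix T *v v = v"
  shows "c < 1 / 2 \<Longrightarrow> c \<le> 2 / 25" "1 / 2 \<le> c \<Longrightarrow> 23 / 25 \<le> c"
proof -
  let ?a = "basis_proj marked *v (Comp *v v)" and ?x = "basis_proj (- marked) *v (Comp *v v)"
  have n: "(norm v)\<^sup>2 > 0" using v by simp
  have cv: "Re (cip v (marked_op *v v)) = c * (norm v)\<^sup>2" by (simp add: v cip_smult Re_cip_self)
  have na: "(norm ?a)\<^sup>2 = c * (norm v)\<^sup>2" using Re_cip_compress[of v marked] cv by simp
  have nx: "(norm ?x)\<^sup>2 = (1 - c) * (norm v)\<^sup>2"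
    using Re_cip_compress[of v "- marked"] cv
    by (simp add: compress_Compl cip_diff Re_cip_self algebra_simps)
  have c0: "0 \<le> c" using na n by (metis zero_le_mult_iff zero_le_power2 not_less)
  have c1: "c \<le> 1" using nx n by (metis zero_le_mult_iff zero_le_power2 not_less diff_ge_0_iff_ge)
  have xin: "basis_proj (db_le T - db_prop P) *v (Comp *v v) = ?x"
    by (rule arg_cong2[where f = "(*v)"], rule arg_cong[where f = basis_proj]) (auto simp: marked_def)
  have "basis_proj (db_le T) *v ?x = ?x" by (simp add: marked_def Int_Un_distrib Int_commute)
  \<comment> \<open>The unmarked part lives on databases of size at most \<open>T\<close>, so the
    size cut-off does not truncate its image.\<close>
  then have Qx: "basis_proj (db_le T) *v (Comp *v (dagger Comp *v ?x)) = Comp *v (dagger Comp *v ?x)"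
    by (metis Comp_dagger_Comp_commute_vec)
  have "Comp *v (dagger Comp *v ?x) = Comp *v (v - of_real c *s v)"
    using compress_Compl[of marked v] by (simp add: compress_vec[of "- marked"] v)
  also have "\<dots> = Comp *v ((1 - c) *\<^sub>R v)" by (simp add: scaleR_eq_smult vec_eq_iff algebra_simps)
  finally have Qx2: "Comp *v (dagger Comp *v ?x) = (1 - c) *\<^sub>R (Comp *v v)" by (simp add: mult_vec_scaleR)
  let ?M = "basis_proj (db_le T \<inter> db_prop P) ** (Comp ** dagger Comp) ** basis_proj (db_le T - db_prop P)"
  have "?M *v (Comp *v v) = basis_proj (db_prop P \<inter> db_le T) *v (Comp *v (dagger Comp *v ?x))"
    by (simp only: matrix_vector_mul_assoc[symmetric] xin Int_commute)
  also have "\<dots> = basis_proj marked *v (basis_proj (db_le T) *v (Comp *v (dagger Comp *v ?x)))"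
    by (simp add: marked_def Int_Un_distrib2)
  also have "\<dots> = (1 - c) *\<^sub>R ?a" unfolding Qx unfolding Qx2 by (simp add: mult_vec_scaleR)
  finally have "norm (?M *v (Comp *v v)) = (1 - c) * norm ?a" using c1 by simp
  moreover have "?M *v (Comp *v v) = ?M *v ?x"
    by (simp only: xin[symmetric] matrix_vector_mul_assoc[symmetric] basis_proj_vec_idem Int_absorb)
  moreover have "norm (?M *v ?x) \<le> 1 / 5 * norm ?x"
    using norm_opnorm[of ?M ?x] mult_right_mono[OF gap, of "norm ?x"] by simp
  ultimately have "(1 - c) * norm ?a \<le> 1 / 5 * norm ?x" by simp
  then have "((1 - c) * norm ?a)\<^sup>2 \<le> (1 / 5 * norm ?x)\<^sup>2" using c1 by (intro power_mono) auto
  then have "(1 - c)\<^sup>2 * c * (norm v)\<^sup>2 \<le> 1 / 25 * (1 - c) * (norm v)\<^sup>2"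
    by (simp add: power_mult_distrib na nx power_divide)
  then have "(1 - c)\<^sup>2 * c \<le> 1 / 25 * (1 - c)" using n by (simp only: mult_le_cancel_right)
  then have "(1 - c) * ((1 - c) * c) \<le> (1 - c) * (1 / 25)" by (simp add: power2_eq_square mult_ac)
  \<comment> \<open>Cancelling \<open>1 - c\<close> requires \<open>c \<noteq> 1\<close>; the case
    \<open>c = 1\<close> belongs to the upper branch.\<close>
  then have g: "c = 1 \<or> (1 - c) * c \<le> 1 / 25"
    using c1 mult_le_cancel_left_pos[of "1 - c" "(1 - c) * c" "1 / 25"] by (cases "c = 1") auto
  show "c \<le> 2 / 25" if "c < 1 / 2"
  proof -
    have "1 / 2 * c \<le> (1 - c) * c" using that c0 by (intro mult_right_mono) auto
    with g that show ?thesis by auto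
  qed
  show "23 / 25 \<le> c" if "1 / 2 \<le> c"
  proof -
    have "(1 - c) * (1 / 2) \<le> (1 - c) * c" using that c1 by (intro mult_left_mono) auto
    with g show ?thesis by auto
  qed
qed

text \<open>On the low space the unmarked compression is the identity minus
  \<open>marked_op\<close>, with eigenvalues at least 23/25, and can be inverted. Thus
  \<open>v\<close> is the image under \<open>dagger Comp\<close> of a vector on unmarked databases
  of almost the same length.\<close>

lemma low_solve:
  assumes v: "v \<in> low_space marked_op" "reach_matrix s *v v = v"
  obtains w where "w \<in> low_space marked_op" "reach_matrix s *v w = w" "compress (- marked) *v w = v"
    "(norm (basis_proj (- marked) *v (Comp *v w)))\<^sup>2 \<le> (norm v)\<^sup>2 / (23 / 25)"
proof -
  let ?W = "low_space marked_op \<inter> {v. reach_matrix s *v v = v}"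
  have "\<exists>w\<in>?W. compress (- marked) *v w = v \<and> Re (cip w v) \<le> (norm v)\<^sup>2 / (23 / 25)"
  proof (rule hermitian_solve[of "compress (- marked)" ?W "23 / 25" v])
    show "vec.subspace ?W"
      by (rule vec.subspace_inter[OF subspace_low_space subspace_fixed])
    fix w assume w: "w \<in> ?W"
    then show "compress (- marked) *v w \<in> ?W"
      using low_space_commuting[of marked_op marked_op w] reach_marked_op[of s w] vec.subspace_diff[OF subspace_low_space]
      by (auto simp: compress_Compl matrix_vector_mult_diff_distrib)
    fix c :: real assume nz: "w \<noteq> 0" and "compress (- marked) *v w = of_real c *s w"
    then have "marked_op *v w = w - of_real c *s w" by (simp add: compress_Compl algebra_simps)
    then have "marked_op *v w = of_real (1 - c) *s w" by (simp add: vec_eq_iff algebra_simps)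
    moreover from this have "1 - c < 1 / 2" using w nz by (intro low_space_eigenvalue[of marked_op w]) auto
    ultimately have "1 - c \<le> 2 / 25" using spectral_gap(1)[of w "1 - c"] w nz low_space_reach by auto
    then show "23 / 25 \<le> c" by simp
  qed (use v in auto)
  then obtain w where w: "w \<in> ?W" "compress (- marked) *v w = v" "Re (cip w v) \<le> (norm v)\<^sup>2 / (23 / 25)"
    by blast
  then show ?thesis using that[of w] Re_cip_compress[of w "- marked"] by auto
qed

text \<open>The mirror image of \<open>low_solve\<close> on the complement of the low space. The
  bound \<open>t \<le> T\<close> places the reachable space for \<open>t\<close> inside the one for
  \<open>T\<close>, where the gap is known.\<close>

lemma high_solve:
  assumes u: "low_proj *v u = 0" "reach_matrix t *v u = u" and t: "t \<le> T"
  obtains w where "reach_matrix t *v w = w" "marked_op *v w = u"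
    "(norm (basis_proj marked *v (Comp *v w)))\<^sup>2 \<le> (norm u)\<^sup>2 / (23 / 25)"
proof -
  let ?W = "{v. low_proj *v v = 0} \<inter> {v. reach_matrix t *v v = v}"
  have "\<exists>w\<in>?W. marked_op *v w = u \<and> Re (cip w u) \<le> (norm u)\<^sup>2 / (23 / 25)"
  proof (rule hermitian_solve[of marked_op ?W "23 / 25" u])
    have "vec.subspace {v. low_proj *v v = 0}"
      by (auto simp: vec.subspace_def matrix_vector_right_distrib vector_scalar_commute)
    then show "vec.subspace ?W" by (rule vec.subspace_inter[OF _ subspace_fixed])
    fix w assume w: "w \<in> ?W"
    then show "marked_op *v w \<in> ?W" by (simp add: low_proj_marked_op reach_marked_op)
    fix c :: real assume nz: "w \<noteq> 0" and e: "marked_op *v w = of_real c *s w"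
    have "reach_matrix T *v w = reach_matrix T *v (reach_matrix t *v w)" using w by simp
    also have "\<dots> = w"
    proof -
      have "db_le T \<inter> db_le t = (db_le t :: ('x \<Rightarrow> 'm mod_ring option) set)" using t by (auto simp: db_le_def)
      then show ?thesis using w compress_reach(1)[of "db_le T" t w] by (simp add: reach_matrix_eq_compress)
    qed
    finally have "reach_matrix T *v w = w" .
    moreover have "\<not> c < 1 / 2"
    proof
      assume "c < 1 / 2"
      then have "w \<in> low_space marked_op" using e unfolding low_space_def by (intro vec.span_base) blast
      then show False using is_orth_projectorD(2)[OF is_orth_projector_low_proj] w nz by auto
    qed
    ultimately show "23 / 25 \<le> c" using spectral_gap(2)[OF nz e] by auto
  qed (use u in auto)
  then obtain w where w: "w \<in> ?W" "marked_op *v w = u" "Re (cip w u) \<le> (norm u)\<^sup>2 / (23 / 25)"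
    by blast
  then show ?thesis using that[of w] Re_cip_compress[of w marked] by auto
qed

text \<open>Both ends of a ladder transition are lifted to databases: \<open>v\<close> comes from an
  unmarked vector and \<open>u\<close> from a marked one. The squared norm of \<open>u\<close> is
  then a matrix element of \<open>comp_oracle\<close>, and each lift costs a factor sqrt
  (25/23).\<close>

lemma transition_bound:
  assumes t: "1 \<le> t" "t \<le> T"
  shows "opnorm ((mat 1 - low_proj) ** reach_matrix t ** phase_oracle x y ** reach_matrix (t - 1) ** low_proj)
    \<le> 25 / 23 * opnorm (basis_proj (db_le t \<inter> db_prop P) ** comp_oracle x y
                ** basis_proj (db_le (t - 1) - db_prop P))"
    (is "opnorm ?B \<le> 25 / 23 * opnorm ?A")
proof (rule opnorm_le)
  fix \<psi> :: "complex ^ ('x \<Rightarrow> 'm mod_ring)"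
  let ?O = "phase_oracle x y :: complex ^ ('x \<Rightarrow> 'm mod_ring) ^ ('x \<Rightarrow> 'm mod_ring)"
  define v where "v = reach_matrix (t - 1) *v (low_proj *v \<psi>)"
  define u where "u = (mat 1 - low_proj) *v (reach_matrix t *v (?O *v v))"
  note LD = is_orth_projectorD[OF is_orth_projector_low_proj]
  have B: "?B *v \<psi> = u" by (simp add: u_def v_def matrix_vector_mul_assoc matrix_mul_assoc)
  have "norm v \<le> norm (low_proj *v \<psi>)" unfolding v_def
    by (rule norm_projector_le) (simp_all add: reach_matrix_projector)
  also have "\<dots> \<le> norm \<psi>" by (rule norm_projector_le) (simp_all add: LD)
  finally have nv: "norm v \<le> norm \<psi>" .
  have v: "v \<in> low_space marked_op" "reach_matrix (t - 1) *v v = v"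
    using LD(1) by (auto simp: v_def reach_matrix_projector intro: reach_low_space)
  have u: "low_proj *v u = 0" "reach_matrix t *v u = u"
    by (simp_all add: u_def matrix_vector_mult_diff_rdistrib matrix_vector_mult_diff_distrib LD
        reach_matrix_projector low_proj_reach_vec)
  obtain w where w: "reach_matrix (t - 1) *v w = w" "compress (- marked) *v w = v"
    "(norm (basis_proj (- marked) *v (Comp *v w)))\<^sup>2 \<le> (norm v)\<^sup>2 / (23 / 25)"
    using low_solve[OF v] by blast
  obtain z where z: "reach_matrix t *v z = z" "marked_op *v z = u"
    "(norm (basis_proj marked *v (Comp *v z)))\<^sup>2 \<le> (norm u)\<^sup>2 / (23 / 25)"
    using high_solve[OF u t(2)] by blast
  let ?a = "basis_proj marked *v (Comp *v z)" and ?b = "basis_proj (- marked) *v (Comp *v w)"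
  have "?a = basis_proj marked *v (basis_proj (db_le t) *v (Comp *v z))"
    by (simp only: reach_supported[OF z(1)])
  \<comment> \<open>Up to size \<open>t \<le> T\<close> no database is oversized, so marking and
    having the property agree.\<close>
  moreover have "marked \<inter> db_le t = db_le t \<inter> db_prop P" using t by (auto simp: marked_def db_le_def)
  ultimately have a: "basis_proj (db_le t \<inter> db_prop P) *v ?a = ?a"
    by simp
  have "?b = basis_proj (- marked) *v (basis_proj (db_le (t - 1)) *v (Comp *v w))"
    by (simp only: reach_supported[OF w(1)])
  moreover have "- marked \<inter> db_le (t - 1) = db_le (t - 1) - db_prop P" using t by (auto simp: marked_def db_le_def)
  ultimately have b: "basis_proj (db_le (t - 1) - db_prop P) *v ?b = ?b"
    by simp
  \<comment> \<open>The two projectors that produce \<open>u\<close> from the queried state both fix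
    \<open>u\<close>, so they drop out of the inner product.\<close>
  have "cip u u = cip u (?O *v v)"
  proof -
    have "cip u u = cip u (reach_matrix t *v (?O *v v)) - cip u (low_proj *v (reach_matrix t *v (?O *v v)))"
      by (subst (2) u_def) (simp add: matrix_vector_mult_diff_rdistrib cip_diff)
    also have "cip u (low_proj *v (reach_matrix t *v (?O *v v))) = 0" using u by (simp add: LD(6)[symmetric])
    also have "cip u (reach_matrix t *v (?O *v v)) = cip (reach_matrix t *v u) (?O *v v)"
      by (subst cip_dagger) (simp add: reach_matrix_projector)
    finally show ?thesis using u by simp
  qed
  also have "\<dots> = cip (dagger Comp *v ?a) (?O *v (dagger Comp *v ?b))"
    by (simp only: z(2)[symmetric] w(2)[symmetric] compress_vec)
  also have "\<dots> = cip ?a (comp_oracle x y *v ?b)"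
    by (simp add: cip_dagger' comp_oracle_def dagger_mult matrix_vector_mul_assoc matrix_mul_assoc)
  also have "\<dots> = cip (basis_proj (db_le t \<inter> db_prop P) *v ?a)
      (comp_oracle x y *v (basis_proj (db_le (t - 1) - db_prop P) *v ?b))"
    by (simp only: a b)
  also have "\<dots> = cip ?a (?A *v ?b)"
    by (simp only: cip_dagger' dagger_basis_proj dagger_mult matrix_vector_mul_assoc matrix_mul_assoc)
  finally have "(norm u)\<^sup>2 = Re (cip ?a (?A *v ?b))" by (metis Re_cip_self)
  also have "\<dots> \<le> norm ?a * norm (?A *v ?b)"
    using cip_Cauchy_Schwarz complex_Re_le_cmod order_trans by blast
  also have "\<dots> \<le> norm ?a * (opnorm ?A * norm ?b)" by (intro mult_left_mono norm_opnorm) auto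
  also have "\<dots> = opnorm ?A * (norm ?a * norm ?b)" by simp
  also have "\<dots> \<le> opnorm ?A * (25 / 23 * (norm u * norm v))"
  proof (rule mult_left_mono[OF _ opnorm_nonneg])
    have "(norm ?a * norm ?b)\<^sup>2 \<le> ((norm u)\<^sup>2 / (23 / 25)) * ((norm v)\<^sup>2 / (23 / 25))"
      unfolding power_mult_distrib by (rule mult_mono[OF z(3) w(3)]) auto
    also have "\<dots> = (25 / 23 * (norm u * norm v))\<^sup>2" by (simp add: power2_eq_square)
    finally show "norm ?a * norm ?b \<le> 25 / 23 * (norm u * norm v)"
      by (rule power2_le_imp_le) auto
  qed
  finally have "norm u * norm u \<le> norm u * (25 / 23 * opnorm ?A * norm v)"
    by (simp add: power2_eq_square mult_ac)
  then have "norm u \<le> 25 / 23 * opnorm ?A * norm v"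
    using opnorm_nonneg[of ?A] by (cases "u = 0") auto
  also have "\<dots> \<le> 25 / 23 * opnorm ?A * norm \<psi>"
    using nv opnorm_nonneg[of ?A] by (intro mult_left_mono) auto
  finally show "norm (?B *v \<psi>) \<le> 25 / 23 * opnorm ?A * norm \<psi>" by (simp only: B)
qed

end
end

section \<open>Solutions on the low space\<close>

text \<open>Everything factors over the sites. At a site of \<open>S\<close> a single entry
  \<open>r = 1 - 1 / CARD('m)\<close> of \<open>comp1\<close> survives; it enters twice, and the
  diagonal entry of \<open>comp1 ** dagger comp1\<close> contributes a third \<open>r\<close>. At
  the other sites the isometry cancels to the identity.\<close>

lemma tensor_pattern:
  fixes S :: "'x::finite set" and y :: "'x \<Rightarrow> 'm::finite mod_ring"
  defines "F \<equiv> basis_proj {f. \<forall>x\<in>S. f x = y x}"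
    and "G \<equiv> basis_proj {D. \<forall>x\<in>S. D x = Some (y x)} ** Comp"
    and "\<beta> \<equiv> (1 - 1 / real CARD('m)) ^ card S"
  shows "dagger (G ** F) ** (G ** F) = \<beta>\<^sup>2 *\<^sub>R F"
    and "dagger (G ** F) ** (Comp ** dagger Comp) ** (G ** F) = \<beta> ^ 3 *\<^sub>R F"
proof -
  define r where "r = 1 - 1 / real CARD('m)"
  define A where "A x = (if x \<in> S then {y x} else UNIV)" for x
  define B where "B x = (if x \<in> S then {Some (y x)} else UNIV)" for x
  define g where "g x = basis_proj (B x) ** comp1 ** (basis_proj (A x) :: complex ^ ('m mod_ring) ^ 'm mod_ring)" for x
  have F: "F = tensor (\<lambda>x. basis_proj (A x))"
    unfolding tensor_basis_proj F_def by (rule arg_cong[where f = basis_proj]) (auto simp: A_def split: if_splits)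
  have "basis_proj {D. \<forall>x\<in>S. D x = Some (y x)} = (tensor (\<lambda>x. basis_proj (B x)) :: complex ^ _ ^ _)"
    unfolding tensor_basis_proj by (rule arg_cong[where f = basis_proj]) (auto simp: B_def split: if_splits)
  then have GF: "G ** F = tensor g" by (simp add: G_def F Comp_eq_tensor tensor_mult g_def[abs_def])
  have gS: "g x $ d $ z = (if d = Some (y x) \<and> z = y x then of_real r else 0)" if "x \<in> S" for x d z
    using that by (simp add: g_def A_def B_def basis_proj_mult_nth mult_basis_proj_nth comp1_Some r_def)
  have 1: "dagger (g x) ** g x = (if x \<in> S then r\<^sup>2 else 1) *\<^sub>R basis_proj (A x)" for x
  proof (cases "x \<in> S")
    case True
    have "(dagger (g x) ** g x) $ a $ b = (r\<^sup>2 *\<^sub>R basis_proj {y x}) $ a $ b" for a b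
    proof -
      have "(dagger (g x) ** g x) $ a $ b = (\<Sum>d\<in>UNIV. if d = Some (y x) then
          (if a = y x \<and> b = y x then of_real (r\<^sup>2) else 0) else 0)"
        unfolding matrix_matrix_mult_def dagger_def vec_lambda_beta gS[OF True]
        by (rule sum.cong) (auto simp: power2_eq_square)
      then show ?thesis unfolding vector_scaleR_component by (auto simp: basis_proj_def scaleR_conv_of_real)
    qed
    with True show ?thesis by (simp add: vec_eq_iff A_def)
  qed (simp add: g_def A_def B_def basis_proj_UNIV dagger_comp1_comp1)
  have 2: "dagger (g x) ** (comp1 ** dagger comp1) ** g x = (if x \<in> S then r ^ 3 else 1) *\<^sub>R basis_proj (A x)" for x
  proof (cases "x \<in> S")
    case True
    let ?Q = "comp1 ** dagger comp1"
    have "(dagger (g x) ** ?Q) $ a $ d = (if a = y x then of_real r * ?Q $ Some (y x) $ d else 0)" for a d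
    proof -
      have "(dagger (g x) ** ?Q) $ a $ d = (\<Sum>c\<in>UNIV. if c = Some (y x) then
          (if a = y x then of_real r * ?Q $ Some (y x) $ d else 0) else 0)"
        unfolding matrix_matrix_mult_def[of "dagger (g x)"] vec_lambda_beta
        unfolding dagger_def[of "g x"] vec_lambda_beta gS[OF True]
        by (rule sum.cong) auto
      then show ?thesis by simp
    qed
    note gQ = this
    have "(dagger (g x) ** ?Q ** g x) $ a $ b = (r ^ 3 *\<^sub>R basis_proj {y x}) $ a $ b" for a b
    proof -
      have "(dagger (g x) ** ?Q ** g x) $ a $ b = (\<Sum>d\<in>UNIV. if d = Some (y x) then
          (if a = y x \<and> b = y x then of_real (r ^ 3) else 0) else 0)"
        unfolding matrix_matrix_mult_def[of "dagger (g x) ** ?Q"] vec_lambda_beta gS[OF True] gQ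
        by (rule sum.cong) (auto simp: comp1_dagger_comp1_Some r_def power3_eq_cube)
      then show ?thesis unfolding vector_scaleR_component by (auto simp: basis_proj_def scaleR_conv_of_real)
    qed
    with True show ?thesis by (simp add: vec_eq_iff A_def)
  next
    case False
    have "dagger comp1 ** (comp1 ** dagger comp1) ** comp1 = (mat 1 :: complex ^ ('m mod_ring) ^ 'm mod_ring)"
      by (simp add: matrix_mul_assoc dagger_comp1_comp1)
    with False show ?thesis by (simp add: g_def A_def B_def basis_proj_UNIV)
  qed
  have pr: "(\<Prod>x\<in>UNIV. if x \<in> S then c else 1) = c ^ card S" for c :: real
    by (simp add: prod.If_cases)
  have "dagger (G ** F) ** (G ** F) = (r\<^sup>2) ^ card S *\<^sub>R F"
    unfolding GF unfolding F by (simp only: dagger_tensor tensor_mult 1 tensor_scaleR pr)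
  then show "dagger (G ** F) ** (G ** F) = \<beta>\<^sup>2 *\<^sub>R F"
    by (simp add: \<beta>_def r_def power_mult[symmetric] mult.commute)
  have "dagger (G ** F) ** (Comp ** dagger Comp) ** (G ** F) = (r ^ 3) ^ card S *\<^sub>R F"
    unfolding GF unfolding F by (simp only: Comp_eq_tensor dagger_tensor tensor_mult 2 tensor_scaleR pr)
  then show "dagger (G ** F) ** (Comp ** dagger Comp) ** (G ** F) = \<beta> ^ 3 *\<^sub>R F"
    by (simp add: \<beta>_def r_def power_mult[symmetric] mult.commute)
qed

text \<open>The two summands arise in \<open>opnorm_pattern_low\<close>. With sqrt (1 - \<beta>)
  factored out, it remains to bound \<open>sqrt (1 + \<beta> - \<beta>\<^sup>2) + \<beta> * sqrt (2
  / 23)\<close> by sqrt 2.\<close>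

lemma sqrt_beta_bound:
  fixes \<beta> :: real
  assumes "0 \<le> \<beta>" "\<beta> \<le> 1"
  shows "sqrt (1 - 2 * \<beta>\<^sup>2 + \<beta> ^ 3) + sqrt (\<beta>\<^sup>2 - \<beta> ^ 3) * sqrt (2 / 23) \<le> sqrt (2 * (1 - \<beta>))"
proof -
  have e: "1 - 2 * \<beta>\<^sup>2 + \<beta> ^ 3 = (1 - \<beta>) * (1 + \<beta> - \<beta>\<^sup>2)" "\<beta>\<^sup>2 - \<beta> ^ 3 = (1 - \<beta>) * \<beta>\<^sup>2"
    by (simp_all add: algebra_simps power2_eq_square power3_eq_cube)
  have "sqrt (1 - 2 * \<beta>\<^sup>2 + \<beta> ^ 3) + sqrt (\<beta>\<^sup>2 - \<beta> ^ 3) * sqrt (2 / 23)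
      = sqrt (1 - \<beta>) * (sqrt (1 + \<beta> - \<beta>\<^sup>2) + \<beta> * sqrt (2 / 23))"
    unfolding e using assms by (simp add: real_sqrt_mult distrib_left)
  also have "\<dots> \<le> sqrt (1 - \<beta>) * sqrt 2"
  proof (rule mult_left_mono)
    \<comment> \<open>The tangent bound sqrt (1 + u) \<le> 1 + u/2.\<close>
    have "sqrt (1 + \<beta> - \<beta>\<^sup>2) \<le> 1 + (\<beta> - \<beta>\<^sup>2) / 2"
    proof (rule real_le_lsqrt)
      have "\<beta>\<^sup>2 \<le> \<beta>" using assms by (simp add: power2_eq_square mult_left_le_one_le)
      then show "0 \<le> 1 + (\<beta> - \<beta>\<^sup>2) / 2" by simp
      have "(1 + (\<beta> - \<beta>\<^sup>2) / 2)\<^sup>2 = 1 + \<beta> - \<beta>\<^sup>2 + ((\<beta> - \<beta>\<^sup>2) / 2)\<^sup>2"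
        by (simp add: field_simps power2_eq_square)
      then show "1 + \<beta> - \<beta>\<^sup>2 \<le> (1 + (\<beta> - \<beta>\<^sup>2) / 2)\<^sup>2" by simp
    qed
    moreover have "sqrt (2 / 23) \<le> 3 / 10" by (rule real_le_lsqrt) (auto simp: power2_eq_square)
    then have "\<beta> * sqrt (2 / 23) \<le> \<beta> * (3 / 10)" using assms by (intro mult_left_mono)
    \<comment> \<open>The remaining quadratic \<open>1 + 4/5 \<beta> - \<beta>\<^sup>2 / 2\<close>
      peaks at \<beta> = 4/5 with value 33/25, below 14/10.\<close>
    moreover have eq: "(\<beta> - 4 / 5)\<^sup>2 = \<beta>\<^sup>2 - 8 / 5 * \<beta> + 16 / 25"
      by (simp add: power2_eq_square algebra_simps)
    have "0 \<le> \<beta>\<^sup>2 - 8 / 5 * \<beta> + 16 / 25" unfolding eq[symmetric] by simp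
    then have "1 + (\<beta> - \<beta>\<^sup>2) / 2 + \<beta> * (3 / 10) \<le> 14 / 10"
      by (simp add: field_simps)
    moreover have "14 / 10 \<le> sqrt 2" by (rule real_le_rsqrt) (simp add: power2_eq_square)
    ultimately show "sqrt (1 + \<beta> - \<beta>\<^sup>2) + \<beta> * sqrt (2 / 23) \<le> sqrt 2" by linarith
  qed (use assms in auto)
  also have "\<dots> = sqrt (2 * (1 - \<beta>))" by (simp only: real_sqrt_mult mult.commute)
  finally show ?thesis .
qed

text \<open>This supplies the condition on solution projectors for \<eta> = 2k/M. A list giving two
  values to one site has a zero projector. Otherwise the list becomes a function on its at most
  \<open>k\<close> sites, and Bernoulli's inequality gives
  \<open>1 - \<beta> \<le> k/M\<close>.\<close>

lemma opnorm_pattern_low: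
  fixes P :: "('x::finite \<times> 'm::finite mod_ring) list set"
  assumes gap: "opnorm (basis_proj (db_le T \<inter> db_prop P) ** (Comp ** dagger Comp)
     ** basis_proj (db_le T - db_prop P)) \<le> 1 / 5"
    and p: "p \<in> P" "length p \<le> k"
  shows "(opnorm (basis_proj {f. \<forall>(x, y)\<in>set p. f x = y} ** low_proj P T))\<^sup>2 \<le> 2 * real k / real CARD('m)"
proof (cases "\<exists>f. \<forall>(x, y)\<in>set p. f x = y")
  case False
  then have "basis_proj {f. \<forall>(x, y)\<in>set p. f x = y} = (0 :: complex ^ ('x \<Rightarrow> 'm mod_ring) ^ ('x \<Rightarrow> 'm mod_ring))"
    by (auto simp: basis_proj_def vec_eq_iff)
  then have "opnorm (basis_proj {f. \<forall>(x, y)\<in>set p. f x = y} ** low_proj P T) = 0"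
    by (intro antisym opnorm_nonneg opnorm_le) (simp add: matrix_matrix_mult_def matrix_vector_mult_def vec_eq_iff)
  then show ?thesis by simp
next
  case True
  then obtain f0 where f0: "\<And>x y. (x, y) \<in> set p \<Longrightarrow> f0 x = y" by fast
  define S where "S = fst ` set p"
  let ?C = "Comp :: complex ^ ('x \<Rightarrow> 'm mod_ring) ^ ('x \<Rightarrow> 'm mod_ring option)"
  let ?Cd = "dagger ?C"
  let ?F = "basis_proj {f. \<forall>x\<in>S. f x = f0 x} :: complex ^ ('x \<Rightarrow> 'm mod_ring) ^ ('x \<Rightarrow> 'm mod_ring)"
  let ?pat = "{D. \<forall>x\<in>S. D x = Some (f0 x)}"
  let ?Y = "basis_proj ?pat :: complex ^ ('x \<Rightarrow> 'm mod_ring option) ^ ('x \<Rightarrow> 'm mod_ring option)"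
  define \<beta> where "\<beta> = (1 - 1 / real CARD('m)) ^ card S"
  have F: "{f. \<forall>(x, y)\<in>set p. f x = y} = {f. \<forall>x\<in>S. f x = f0 x}"
    using f0 by (auto simp: S_def)
  have pat: "?pat \<subseteq> marked P T"
    using p(1) f0 by (fastforce simp: marked_def db_prop_def S_def)
  have \<beta>: "0 \<le> \<beta>" "\<beta> \<le> 1" "1 - \<beta> \<le> real k / real CARD('m)"
  proof -
    have "0 \<le> 1 - 1 / real CARD('m)" "1 - 1 / real CARD('m) \<le> 1" by simp_all
    then show "0 \<le> \<beta>" "\<beta> \<le> 1" unfolding \<beta>_def by (simp_all only: zero_le_power power_le_one)
    have "1 + real (card S) * (- 1 / real CARD('m)) \<le> (1 + (- 1 / real CARD('m))) ^ card S"
      by (rule Bernoulli_inequality) (simp add: field_simps)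
    then have "1 - \<beta> \<le> real (card S) / real CARD('m)" by (simp add: \<beta>_def)
    moreover have "card S \<le> k"
      using card_image_le[of "set p" fst] card_length[of p] p(2) by (simp add: S_def)
    ultimately show "1 - \<beta> \<le> real k / real CARD('m)" by (meson divide_right_mono of_nat_0_le_iff of_nat_le_iff order_trans)
  qed
  have bound: "norm (?F *v v) \<le> sqrt (2 * (1 - \<beta>)) * norm v" if v: "v \<in> low_space (marked_op P T)" for v
  proof -
    obtain w where w: "compress (- marked P T) *v w = v"
      "(norm (basis_proj (- marked P T) *v (?C *v w)))\<^sup>2 \<le> (norm v)\<^sup>2 / (23 / 25)"
      using low_solve[OF gap v low_space_reach[OF v]] by blast
    define \<eta> where "\<eta> = basis_proj (- marked P T) *v (?C *v w)"
    define e where "e = ?F *v v"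
    define g where "g = ?Y *v (?C *v e)"
    define \<zeta> where "\<zeta> = \<eta> - ?C *v v"
    \<comment> \<open>As \<open>\<eta>\<close> misses the pattern, \<open>\<langle>e, v\<rangle> = \<langle>C e - g, \<eta>\<rangle>\<close>.  The part \<open>\<zeta>\<close> of \<open>\<eta>\<close>
      orthogonal to the range of \<open>C\<close> is small by the spectral gap, and this keeps the total
      below \<open>2k/M\<close> although \<open>C e - g\<close> alone has squared norm close to \<open>2k/M\<close>.\<close>
    have Fe: "?F *v e = e" by (simp add: e_def)
    have C\<eta>: "?Cd *v \<eta> = v" using w(1) by (simp add: \<eta>_def compress_vec)
    have C\<zeta>: "?Cd *v \<zeta> = 0" by (simp add: \<zeta>_def matrix_vector_mult_diff_distrib C\<eta>)
    have Y\<eta>: "?Y *v \<eta> = 0"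
      using pat by (auto simp: \<eta>_def vec_eq_iff basis_proj_vec_nth)
    have gGF: "g = (?Y ** ?C ** ?F) *v e" by (simp add: g_def Fe flip: matrix_vector_mul_assoc)
    have ng: "(norm g)\<^sup>2 = \<beta>\<^sup>2 * (norm e)\<^sup>2"
    proof -
      have "cip g g = cip e ((dagger (?Y ** ?C ** ?F) ** (?Y ** ?C ** ?F)) *v e)"
        by (simp only: gGF cip_dagger' matrix_vector_mul_assoc)
      also have "\<dots> = of_real (\<beta>\<^sup>2) * cip e e"
        unfolding tensor_pattern(1) \<beta>_def[symmetric]
        by (simp add: scaleR_mult_vec Fe scaleR_eq_smult cip_smult)
      finally have "Re (cip g g) = Re (of_real (\<beta>\<^sup>2) * cip e e)" by simp
      then show ?thesis by (simp add: Re_cip_self del: of_real_power)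
    qed
    have nCg: "(norm (?Cd *v g))\<^sup>2 = \<beta> ^ 3 * (norm e)\<^sup>2"
    proof -
      have "cip (?Cd *v g) (?Cd *v g) = cip e ((dagger (?Y ** ?C ** ?F) ** (?C ** ?Cd) ** (?Y ** ?C ** ?F)) *v e)"
        by (simp only: gGF cip_dagger' matrix_vector_mul_assoc matrix_mul_assoc dagger_mult dagger_dagger)
      also have "\<dots> = of_real (\<beta> ^ 3) * cip e e"
        unfolding tensor_pattern(2) \<beta>_def[symmetric]
        by (simp add: scaleR_mult_vec Fe scaleR_eq_smult cip_smult)
      finally have "Re (cip (?Cd *v g) (?Cd *v g)) = Re (of_real (\<beta> ^ 3) * cip e e)" by simp
      then show ?thesis by (simp add: Re_cip_self del: of_real_power)
    qed
    have norm_diff: "(norm (a - b))\<^sup>2 = (norm a)\<^sup>2 - 2 * Re (cip a b) + (norm b)\<^sup>2" for a b :: "complex ^ 'n::finite"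
      by (simp add: power2_norm_eq_inner Re_cip inner_diff_left inner_diff_right inner_commute)
    have "Re (cip e (?Cd *v g)) = (norm g)\<^sup>2"
    proof -
      have "cip g g = cip (?C *v e) (?Y *v g)" by (subst (1) g_def) (simp only: cip_dagger' dagger_basis_proj)
      also have "?Y *v g = g" by (simp add: g_def)
      finally have "cip g g = cip e (?Cd *v g)" by (simp only: cip_dagger')
      then show ?thesis by (metis Re_cip_self)
    qed
    then have n1: "(norm (e - ?Cd *v g))\<^sup>2 = (1 - 2 * \<beta>\<^sup>2 + \<beta> ^ 3) * (norm e)\<^sup>2"
      by (simp add: norm_diff nCg ng algebra_simps)
    have "Re (cip g (?C *v (?Cd *v g))) = (norm (?Cd *v g))\<^sup>2"
      by (simp only: cip_dagger[of g ?C] Re_cip_self)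
    then have n2: "(norm (g - ?C *v (?Cd *v g)))\<^sup>2 = (\<beta>\<^sup>2 - \<beta> ^ 3) * (norm e)\<^sup>2"
      by (simp add: norm_diff norm_Comp nCg ng algebra_simps)
    have "Re (cip \<eta> (?C *v v)) = (norm v)\<^sup>2" by (simp only: cip_dagger C\<eta> Re_cip_self)
    \<comment> \<open>Since \<open>\<eta>\<close> is the orthogonal sum of \<open>Comp v\<close> and
      \<open>\<zeta>\<close>, the latter carries only the excess 25/23 - 1 = 2/23.\<close>
    then have n3: "(norm \<zeta>)\<^sup>2 \<le> 2 / 23 * (norm v)\<^sup>2"
      using w(2) by (simp add: \<zeta>_def norm_diff norm_Comp flip: \<eta>_def)
    have "cip e e = cip e v"
      by (subst (2) Fe[symmetric]) (simp add: e_def cip_dagger' matrix_vector_mul_assoc)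
    also have "\<dots> = cip (?C *v e) \<eta>" by (simp only: C\<eta>[symmetric] cip_dagger dagger_dagger)
    also have "\<dots> = cip (?C *v e) \<eta> - cip g \<eta>"
      by (simp add: g_def cip_dagger' Y\<eta>)
    \<comment> \<open>With \<open>\<eta>\<close> split in this way, \<open>Comp v\<close> sees only
      the component of \<open>Comp e - g\<close> in the range of \<open>Comp\<close>, and
      \<open>\<zeta>\<close> only the component orthogonal to it.\<close>
    also have "\<dots> = cip (?C *v e - g) (?C *v v) + (cip (?C *v e) \<zeta> - cip g \<zeta>)"
      by (simp add: \<zeta>_def cip_diff)
    also have "cip (?C *v e - g) (?C *v v) = cip (e - ?Cd *v g) v"
      by (simp add: cip_dagger matrix_vector_mult_diff_distrib)
    also have "cip (?C *v e) \<zeta> - cip g \<zeta> = - cip (g - ?C *v (?Cd *v g)) \<zeta>"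
      by (simp add: cip_diff cip_dagger' C\<zeta>)
    finally have "(norm e)\<^sup>2 = cmod (cip (e - ?Cd *v g) v + - cip (g - ?C *v (?Cd *v g)) \<zeta>)"
      by (metis cip_self norm_of_real abs_of_nonneg zero_le_power2)
    also have "\<dots> \<le> norm (e - ?Cd *v g) * norm v + norm (g - ?C *v (?Cd *v g)) * norm \<zeta>"
      by (rule order_trans[OF norm_triangle_ineq]) (simp add: add_mono cip_Cauchy_Schwarz)
    also have "\<dots> \<le> (sqrt (1 - 2 * \<beta>\<^sup>2 + \<beta> ^ 3) * norm e) * norm v
        + (sqrt (\<beta>\<^sup>2 - \<beta> ^ 3) * norm e) * (sqrt (2 / 23) * norm v)"
    proof -
      have "norm (e - ?Cd *v g) = sqrt (1 - 2 * \<beta>\<^sup>2 + \<beta> ^ 3) * norm e"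
        using arg_cong[OF n1, of sqrt] by (simp add: real_sqrt_mult)
      moreover have "norm (g - ?C *v (?Cd *v g)) = sqrt (\<beta>\<^sup>2 - \<beta> ^ 3) * norm e"
        using arg_cong[OF n2, of sqrt] by (simp add: real_sqrt_mult)
      moreover have "norm \<zeta> \<le> sqrt (2 / 23) * norm v"
        by (rule power2_le_imp_le) (use n3 in \<open>simp_all add: power_mult_distrib\<close>)
      moreover have "0 \<le> norm (g - ?C *v (?Cd *v g))" by simp
      ultimately show ?thesis by (metis add_left_mono mult_left_mono)
    qed
    also have "\<dots> = (sqrt (1 - 2 * \<beta>\<^sup>2 + \<beta> ^ 3) + sqrt (\<beta>\<^sup>2 - \<beta> ^ 3) * sqrt (2 / 23)) * (norm e * norm v)"
      by (simp add: algebra_simps)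
    also have "\<dots> \<le> sqrt (2 * (1 - \<beta>)) * (norm e * norm v)"
      by (rule mult_right_mono[OF sqrt_beta_bound]) (use \<beta> in auto)
    finally have "norm e * norm e \<le> norm e * (sqrt (2 * (1 - \<beta>)) * norm v)"
      by (simp add: power2_eq_square mult_ac)
    then have "norm e \<le> sqrt (2 * (1 - \<beta>)) * norm v"
      using \<beta> by (cases "e = 0") auto
    then show ?thesis by (simp add: e_def)
  qed
  note LD = is_orth_projectorD[OF is_orth_projector_low_proj[of P T]]
  have "opnorm (?F ** low_proj P T) \<le> sqrt (2 * (1 - \<beta>))"
  proof (rule opnorm_le)
    fix \<psi> :: "complex ^ ('x \<Rightarrow> 'm mod_ring)"
    have "norm ((?F ** low_proj P T) *v \<psi>) \<le> sqrt (2 * (1 - \<beta>)) * norm (low_proj P T *v \<psi>)"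
      using bound[OF LD(1)] by (simp add: matrix_vector_mul_assoc)
    also have "\<dots> \<le> sqrt (2 * (1 - \<beta>)) * norm \<psi>"
      using \<beta> by (intro mult_left_mono norm_projector_le) (auto simp: LD)
    finally show "norm ((?F ** low_proj P T) *v \<psi>) \<le> sqrt (2 * (1 - \<beta>)) * norm \<psi>" .
  qed
  then have "(opnorm (?F ** low_proj P T))\<^sup>2 \<le> (sqrt (2 * (1 - \<beta>)))\<^sup>2"
    by (intro power_mono opnorm_nonneg)
  also have "\<dots> = 2 * (1 - \<beta>)" using \<beta> by simp
  also have "\<dots> \<le> 2 * real k / real CARD('m)" using \<beta>(3) by simp
  finally show ?thesis by (simp only: F)
qed

section \<open>Comparison of the bounds\<close>

definition comp_term :: "('x::finite \<times> 'm::finite mod_ring) list set \<Rightarrow> nat \<Rightarrow> real" where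
  "comp_term P t = (MAX (x, y) \<in> UNIV \<times> UNIV.
        opnorm (basis_proj (db_le t \<inter> db_prop P) ** comp_oracle x y
                ** basis_proj (db_le (t - 1) - db_prop P)))"

lemma comp_term_ge:
  "opnorm (basis_proj (db_le t \<inter> db_prop P) ** comp_oracle x y ** basis_proj (db_le (t - 1) - db_prop P))
    \<le> comp_term P t"
  unfolding comp_term_def by (rule Max_ge) (auto intro!: image_eqI[of _ _ "(x, y)"])

lemma comp_term_le:
  assumes "\<And>x y. opnorm (basis_proj (db_le t \<inter> db_prop P) ** comp_oracle x y
    ** basis_proj (db_le (t - 1) - db_prop P)) \<le> b"
  shows "comp_term P t \<le> b"
  unfolding comp_term_def using assms by (intro Max.boundedI) auto

lemma comp_term_nonneg: "0 \<le> comp_term P t"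
  using order_trans[OF opnorm_nonneg comp_term_ge] .

text \<open>The smaller projectors factor through the larger ones, and projectors are
  contractions.\<close>

lemma opnorm_basis_proj_mono:
  assumes "A \<subseteq> A'" "B \<subseteq> B'"
  shows "opnorm (basis_proj A ** M ** basis_proj B) \<le> opnorm (basis_proj A' ** M ** basis_proj B')"
proof (rule opnorm_le)
  fix v
  let ?N = "basis_proj A' ** M ** basis_proj B'"
  have contract: "norm (basis_proj S *v w) \<le> norm w" for S and w :: "complex ^ 'n::finite"
    by (rule norm_projector_le) simp_all
  have "basis_proj A ** M ** basis_proj B = (basis_proj A ** basis_proj A') ** M ** (basis_proj B' ** basis_proj B)"
    using assms by (simp add: Int_absorb1 Int_absorb2)
  then have "(basis_proj A ** M ** basis_proj B) *v v = basis_proj A *v (?N *v (basis_proj B *v v))"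
    by (simp only: matrix_vector_mul_assoc matrix_mul_assoc)
  then have "norm ((basis_proj A ** M ** basis_proj B) *v v) \<le> norm (?N *v (basis_proj B *v v))"
    by (simp only: contract)
  also have "\<dots> \<le> opnorm ?N * norm (basis_proj B *v v)" by (rule norm_opnorm)
  also have "\<dots> \<le> opnorm ?N * norm v" by (intro mult_left_mono contract opnorm_nonneg)
  finally show "norm ((basis_proj A ** M ** basis_proj B) *v v) \<le> opnorm ?N * norm v" .
qed

lemma db_le_mono: "s \<le> t \<Longrightarrow> db_le s \<subseteq> db_le t"
  by (auto simp: db_le_def)

lemma comp_term_mono:
  assumes "s \<le> t" shows "comp_term P s \<le> comp_term P t"
proof (rule comp_term_le)
  fix x y
  have "db_le s \<inter> db_prop P \<subseteq> db_le t \<inter> db_prop P" using db_le_mono[OF assms] by auto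
  moreover have "db_le (s - 1) - db_prop P \<subseteq> db_le (t - 1) - db_prop P"
    using db_le_mono[OF diff_le_mono[OF assms]] by blast
  ultimately show "opnorm (basis_proj (db_le s \<inter> db_prop P) ** comp_oracle x y
      ** basis_proj (db_le (s - 1) - db_prop P)) \<le> comp_term P t"
    by (rule order_trans[OF opnorm_basis_proj_mono comp_term_ge])
qed

lemma comp_oracle_0: "comp_oracle x 0 = Comp ** dagger Comp"
proof -
  have "phase_oracle x 0 = (mat 1 :: complex ^ ('a \<Rightarrow> 'b mod_ring) ^ ('a \<Rightarrow> 'b mod_ring))"
    by (simp add: phase_oracle_def mat_def vec_eq_iff)
  then show ?thesis by (simp add: comp_oracle_def)
qed

text \<open>The query with value 0 is the identity, so after enlarging the first projector this norm
  is a candidate in the maximum for \<open>Suc T\<close>. The index shift is what leaves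
  \<open>db_le T\<close> on the right.\<close>

lemma idle_term_le:
  "opnorm (basis_proj (db_le T \<inter> db_prop P) ** (Comp ** dagger Comp) ** basis_proj (db_le T - db_prop P))
    \<le> comp_term P (Suc T)"
proof -
  have "db_le T \<inter> db_prop P \<subseteq> db_le (Suc T) \<inter> db_prop P" using db_le_mono[of T "Suc T"] by auto
  from opnorm_basis_proj_mono[OF this order_refl, of "Comp ** dagger Comp" "db_le T - db_prop P"]
  show ?thesis using comp_term_ge[of "Suc T" P undefined 0] by (simp add: comp_oracle_0)
qed

section \<open>Admissibility of the two-level matrix\<close>

lemma empty_database_unmarked:
  assumes "\<And>p. p \<in> P \<Longrightarrow> p \<noteq> []" "db_size D = 0"
  shows "D \<notin> db_prop P"
proof
  assume "D \<in> db_prop P"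
  then obtain p where p: "p \<in> P" "\<forall>(x, y)\<in>set p. D x = Some y" by (auto simp: db_prop_def)
  with assms(1) obtain x y where "(x, y) \<in> set p" by (cases p) auto
  with p assms(2) show False by (auto simp: db_size_def)
qed

text \<open>The uniform state compresses to the empty database, which is unmarked, so it is an
  eigenvector of \<open>marked_op\<close> with eigenvalue 0.\<close>

lemma dist_state_low_space:
  fixes P :: "('x::finite \<times> 'm::finite mod_ring) list set"
  assumes "\<And>p. p \<in> P \<Longrightarrow> p \<noteq> []"
  shows "dist_state (pmf_of_set (UNIV :: ('x \<Rightarrow> 'm mod_ring) set)) \<in> low_space (marked_op P T)"
proof -
  let ?d = "dist_state (pmf_of_set (UNIV :: ('x \<Rightarrow> 'm mod_ring) set))"
  obtain r :: real where d: "?d = r *\<^sub>R cond_indicator [] []" using dist_state_uniform by metis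
  have "(basis_proj (marked P T) *v (Comp *v ?d)) $ D = 0" for D
  proof (cases "db_size D = 0")
    case True
    then have "D \<notin> marked P T"
      using empty_database_unmarked[OF assms] by (auto simp: marked_def db_le_def)
    then show ?thesis by (simp add: basis_proj_vec_nth)
  next
    case False
    then obtain x w where "D x = Some w" by (force simp: db_size_def)
    then show ?thesis by (simp add: basis_proj_vec_nth d mult_vec_scaleR Comp_cond_indicator)
  qed
  then have "basis_proj (marked P T) *v (Comp *v ?d) = 0" by (simp add: vec_eq_iff)
  then have "marked_op P T *v ?d = of_real 0 *s ?d" by (simp add: compress_vec)
  then show ?thesis unfolding low_space_def
    by (intro vec.span_base) (metis (mono_tags, lifting) half_gt_zero_iff mem_Collect_eq zero_less_one)
qed

lemma admissible_low_proj:
  fixes P :: "('x::finite \<times> 'm::finite mod_ring) list set"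
  assumes gap: "opnorm (basis_proj (db_le T \<inter> db_prop P) ** (Comp ** dagger Comp)
     ** basis_proj (db_le T - db_prop P)) \<le> 1 / 5"
    and len: "\<And>p. p \<in> P \<Longrightarrow> length p = k" and k: "1 \<le> k" "2 * real k / real CARD('m) < 1"
    and ex: "\<exists>f. property_search P f \<noteq> {}" and \<kappa>: "1 < \<kappa>"
  shows "admissible (pmf_of_set (UNIV :: ('x \<Rightarrow> 'm mod_ring) set)) (2 * real k / real CARD('m)) P
    (property_search P) (two_level (low_proj P T) \<kappa>) \<kappa> 1 \<kappa>"
proof -
  let ?d = "dist_state (pmf_of_set (UNIV :: ('x \<Rightarrow> 'm mod_ring) set))"
  have ne: "p \<noteq> []" if "p \<in> P" for p using len[OF that] k by auto
  have sol: "(opnorm (solution_proj (property_search P) z ** low_proj P T))\<^sup>2 \<le> 2 * real k / real CARD('m)"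
    if "z \<in> P" for z
    using opnorm_pattern_low[OF gap that, of k] len[OF that] that
    by (simp add: solution_proj_def property_search_def)
  have nz: "?d \<noteq> 0"
  proof -
    obtain r :: real where "r \<noteq> 0" "?d = r *\<^sub>R cond_indicator [] []" using dist_state_uniform by metis
    then show ?thesis by (simp add: vec_eq_iff cond_indicator_def consistent_def)
  qed
  \<comment> \<open>Were the low space everything, \<open>sol\<close> would bound the norm of a
    solution projector itself below 1, although for a list solved by some function this projector is
    nonzero.\<close>
  have "\<exists>v. v \<notin> low_space (marked_op P T)"
  proof (rule ccontr)
    assume "\<not> ?thesis"
    then have "low_proj P T *v v = v" for v
      using is_orth_projectorD(2)[OF is_orth_projector_low_proj[of P T]] by blast
    then have one: "low_proj P T = mat 1" by (simp add: matrix_eq)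
    obtain f z where z: "z \<in> P" "z \<in> property_search P f"
      using ex by (auto simp: property_search_def)
    let ?F = "solution_proj (property_search P) z"
    have "?F *v axis f 1 = axis f 1"
      using z by (simp add: solution_proj_def vec_eq_iff basis_proj_vec_nth axis_def)
    then have "1 \<le> opnorm ?F" using norm_opnorm[of ?F "axis f 1"] by simp
    then have "1 \<le> (opnorm ?F)\<^sup>2" by (simp add: one_le_power)
    with sol[OF z(1)] k show False by (simp add: one)
  qed
  then obtain v1 where v1: "v1 \<notin> low_space (marked_op P T)" by blast
  show ?thesis
    by (rule admissible_two_level[OF is_orth_projector_low_proj \<kappa> _ dist_state_low_space[OF ne] nz v1 sol])
      (simp_all add: reach_proj_uniform low_proj_reach)
qed

text \<open>The long sum splits into \<open>n\<close> blocks of length \<open>T\<close>, and by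
  monotonicity each dominates the first.\<close>

lemma sum_block_le:
  fixes a :: "nat \<Rightarrow> real"
  assumes mono: "\<And>s t. s \<le> t \<Longrightarrow> a s \<le> a t"
  shows "real n * (\<Sum>t=1..T. a t) \<le> (\<Sum>t=1..n * T. a t)"
proof (induction n)
  case (Suc n)
  have "(\<Sum>t=1..Suc n * T. a t) = (\<Sum>t=1..n * T. a t) + (\<Sum>t=n * T + 1..n * T + T. a t)"
    using sum.ub_add_nat[of 1 "n * T" a T] by (simp add: add.commute)
  moreover have "(\<Sum>t=n * T + 1..n * T + T. a t) = (\<Sum>t=1..T. a (t + n * T))"
    using sum.shift_bounds_cl_nat_ivl[of a 1 "n * T" T] by (simp add: add.commute)
  moreover have "(\<Sum>t=1..T. a t) \<le> (\<Sum>t=1..T. a (t + n * T))"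
    by (intro sum_mono mono) simp
  ultimately show ?case using Suc by (simp add: algebra_simps)
qed simp

text \<open>For this \<kappa> the left side of \<open>prod\<close> equals 5, so ln 5 \<ge> 3/2 is at
  most twice the sum of the \<open>m t\<close>. As (\<kappa> - 1) / sqrt \<kappa> \<le> 2/s, the sum
  of the \<open>a t\<close> is at least 69/200 times \<open>s\<close>, and 200/69 < 3.\<close>

lemma potential_growth:
  fixes a m :: "nat \<Rightarrow> real" and s \<kappa> :: real
  assumes s: "0 < s" and \<kappa>: "\<kappa> = 1 + 4 / s\<^sup>2"
    and m: "\<And>t. t \<in> {1..T} \<Longrightarrow> 0 \<le> m t \<and> m t \<le> (\<kappa> - 1) / sqrt \<kappa> * (25 / 23 * a t)"
    and prod: "1 + (\<kappa> - 1) * s\<^sup>2 \<le> (\<Prod>t=1..T. (1 + m t)\<^sup>2)"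
  shows "s \<le> 3 * (\<Sum>t=1..T. a t)"
proof -
  let ?A = "\<Sum>t=1..T. a t"
  have \<kappa>1: "\<kappa> > 1" using s by (simp add: \<kappa>)
  have "(2 / s)\<^sup>2 \<le> \<kappa>" by (simp add: \<kappa> power_divide)
  then have "2 / s \<le> sqrt \<kappa>" by (rule real_le_rsqrt)
  then have "(\<kappa> - 1) / sqrt \<kappa> \<le> (\<kappa> - 1) / (2 / s)"
    using s \<kappa>1 by (intro divide_left_mono) auto
  also have "\<dots> = 2 / s" using s by (simp add: \<kappa> power2_eq_square)
  finally have c: "(\<kappa> - 1) / sqrt \<kappa> \<le> 2 / s" .
  have c0: "0 < (\<kappa> - 1) / sqrt \<kappa>" using \<kappa>1 by simp
  have a0: "0 \<le> a t" if "t \<in> {1..T}" for t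
  proof -
    have "0 \<le> (\<kappa> - 1) / sqrt \<kappa> * (25 / 23 * a t)" using m[OF that] by linarith
    then have "0 \<le> 25 / 23 * a t"
      using c0 zero_le_mult_iff[of "(\<kappa> - 1) / sqrt \<kappa>" "25 / 23 * a t"] by linarith
    then show ?thesis by simp
  qed
  \<comment> \<open>Squaring reduces this to e^3 \<le> 25, and 2.75^3 is below 21.\<close>
  have "(3 :: real) / 2 \<le> ln 5"
  proof -
    have "exp (3 / 2 :: real) ^ 2 = exp 1 ^ 3"
      by (simp flip: exp_of_nat_mult)
    also have "\<dots> \<le> (2.75 :: real) ^ 3"
      using e_less_272 by (intro power_mono) auto
    also have "\<dots> \<le> 5 ^ 2" by (simp add: power2_eq_square power3_eq_cube)
    finally have "exp (3 / 2 :: real) \<le> 5" by (rule power2_le_imp_le) simp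
    then show ?thesis by (intro ln_ge_iff[THEN iffD2]) simp_all
  qed
  also have "ln 5 \<le> ln (\<Prod>t=1..T. (1 + m t)\<^sup>2)"
    using prod s by (simp add: \<kappa>)
  also have "\<dots> \<le> ln (exp (\<Sum>t=1..T. 2 * m t))"
  proof (rule ln_mono)
    show "0 < (\<Prod>t=1..T. (1 + m t)\<^sup>2)" using prod s by (simp add: \<kappa>)
    have "(\<Prod>t=1..T. (1 + m t)\<^sup>2) \<le> (\<Prod>t=1..T. exp (2 * m t))"
    proof (rule prod_mono)
      fix t assume t: "t \<in> {1..T}"
      have "(1 + m t)\<^sup>2 \<le> (exp (m t))\<^sup>2" using m[OF t] by (intro power_mono exp_ge_add_one_self) auto
      then show "0 \<le> (1 + m t)\<^sup>2 \<and> (1 + m t)\<^sup>2 \<le> exp (2 * m t)" by (simp add: exp_double)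
    qed
    then show "(\<Prod>t=1..T. (1 + m t)\<^sup>2) \<le> exp (\<Sum>t=1..T. 2 * m t)" by (simp add: exp_sum)
  qed
  also have "\<dots> = (\<Sum>t=1..T. 2 * m t)" by simp
  also have "\<dots> \<le> (\<Sum>t=1..T. 100 / (23 * s) * a t)"
  proof (rule sum_mono)
    fix t assume t: "t \<in> {1..T}"
    have "m t \<le> (\<kappa> - 1) / sqrt \<kappa> * (25 / 23 * a t)" using m[OF t] by blast
    also have "\<dots> \<le> 2 / s * (25 / 23 * a t)" using c a0[OF t] by (intro mult_right_mono) auto
    finally show "2 * m t \<le> 100 / (23 * s) * a t" by simp
  qed
  also have "\<dots> = 100 / (23 * s) * ?A" by (simp add: sum_distrib_left)
  finally have "3 / 2 * s \<le> 100 / 23 * ?A" using s by (simp add: field_simps)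
  moreover have "0 \<le> ?A" using a0 by (rule sum_nonneg)
  ultimately show ?thesis by linarith
qed

theorem theorem5p1:
  fixes P :: "('x::finite \<times> 'm::finite mod_ring) list set"
    and k :: nat and \<epsilon> :: real
  assumes "k \<in> {1..CARD('m) - 1}"
    and "\<And>p. p \<in> P \<Longrightarrow> length p = k"
    and "\<exists>f. property_search P f \<noteq> {}"
    and "0 < \<epsilon>" and "\<epsilon> < 1 - (9 - 4 * sqrt 2) * (real k / real CARD('m))"
  shows "COMP \<epsilon> k P
    \<le> 6 * MLADV (pmf_of_set (UNIV :: ('x \<Rightarrow> 'm mod_ring) set)) \<epsilon>
            (2 * real k / real CARD('m)) P (property_search P)"
proof -
  let ?\<delta> = "pmf_of_set (UNIV :: ('x \<Rightarrow> 'm mod_ring) set)"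
  let ?\<eta> = "2 * real k / real CARD('m)"
  define s where "s = sqrt (1 - \<epsilon>) - sqrt ?\<eta>"
  define a where "a = comp_term P"
  define q where "q = sqrt (real k / real CARD('m))"
  have k: "1 \<le> k" using assms(1) by simp
  have q: "q > 0" "q\<^sup>2 = real k / real CARD('m)" using k by (simp_all add: q_def)
  have sq\<eta>: "sqrt ?\<eta> = sqrt 2 * q" by (simp add: q_def real_sqrt_mult[symmetric])
  have sqrt2: "1 < sqrt 2" "sqrt 2 \<le> 3 / 2"
    by (simp, rule real_le_lsqrt) (simp_all add: power2_eq_square)
  \<comment> \<open>The square of 2 sqrt 2 - 1 is 9 - 4 sqrt 2, which explains the range of
    \<epsilon>: the inequality \<open>s2\<close> below is a rearrangement of
    \<open>(2 * sqrt 2 - 1) * q \<le> sqrt (1 - \<epsilon>)\<close>.\<close>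
  have e: "((2 * sqrt 2 - 1) * q)\<^sup>2 < 1 - \<epsilon>"
  proof -
    have "((2 * sqrt 2 - 1) * q)\<^sup>2 = (9 - 4 * sqrt 2) * q\<^sup>2"
      by (simp add: power_mult_distrib power2_diff)
    with assms(5) q(2) show ?thesis by simp
  qed
  have sq\<epsilon>: "(2 * sqrt 2 - 1) * q < sqrt (1 - \<epsilon>)" using e by (rule real_less_rsqrt)
  have "sqrt 2 * q \<le> (2 * sqrt 2 - 1) * q" using sqrt2 q by (intro mult_right_mono) auto
  then have s0: "0 < s" using sq\<epsilon> by (simp add: s_def sq\<eta>)
  have s2: "sqrt (1 - \<epsilon>) - q \<le> 2 * s"
    unfolding s_def sq\<eta> using sq\<epsilon> by (simp add: algebra_simps)
  have \<eta>1: "?\<eta> < 1"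
  proof -
    have "2 * q\<^sup>2 \<le> (9 - 4 * sqrt 2) * q\<^sup>2" using sqrt2 by (intro mult_right_mono) auto
    also have "\<dots> < 1" unfolding q(2) using assms(4,5) by linarith
    finally show ?thesis using q(2) by simp
  qed
  \<comment> \<open>The constant 6 is 2 times 3 for a small idle norm, from \<open>s2\<close> and
    \<open>potential_growth\<close>, and 1 + 5 for a large one.\<close>
  have main: "COMP \<epsilon> k P \<le> enat (6 * T)"
    if T: "\<forall>\<Gamma> \<kappa> l lam. admissible ?\<delta> ?\<eta> P (property_search P) \<Gamma> \<kappa> l lam \<longrightarrow>
     1 + (lam - 1) * (sqrt (1 - \<epsilon>) - sqrt ?\<eta>)\<^sup>2 \<le>
     (\<Prod>t=1..T. (1 + (MAX (i, x, y) \<in> {0..l - 1} \<times> UNIV \<times> UNIV.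
        (\<kappa> - 1) / sqrt \<kappa> *
        opnorm (ladder_proj \<Gamma> \<kappa> (i + 1) ** reach_proj ?\<delta> t ** phase_oracle x y
                ** reach_proj ?\<delta> (t - 1) ** ladder_proj \<Gamma> \<kappa> i)))\<^sup>2)" for T
  proof -
    let ?idle = "opnorm (basis_proj (db_le T \<inter> db_prop P) ** (Comp ** dagger Comp) ** basis_proj (db_le T - db_prop P))"
    have "sqrt (1 - \<epsilon>) - q \<le> (\<Sum>t=1..6 * T. a t)"
    proof (cases "?idle \<le> 1 / 5")
      case True
      define \<kappa> where "\<kappa> = 1 + 4 / s\<^sup>2"
      have \<kappa>: "1 < \<kappa>" using s0 by (simp add: \<kappa>_def)
      let ?\<Gamma> = "two_level (low_proj P T) \<kappa>"
      \<comment> \<open>With \<open>l = 1\<close> only \<open>i = 0\<close> occurs; the range is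
        written with \<open>1 - 1\<close> to match the instance of the hypothesis
        \<open>T\<close>.\<close>
      define m where "m t = (MAX (i, x, y) \<in> {0..1 - 1 :: nat} \<times> UNIV \<times> UNIV.
        (\<kappa> - 1) / sqrt \<kappa> *
        opnorm (ladder_proj ?\<Gamma> \<kappa> (i + 1) ** reach_proj ?\<delta> t ** phase_oracle x y
                ** reach_proj ?\<delta> (t - 1) ** ladder_proj ?\<Gamma> \<kappa> i))" for t
      note la = ladder_proj_two_level[OF is_orth_projector_low_proj[of P T] \<kappa>]
      have c0: "0 < (\<kappa> - 1) / sqrt \<kappa>" using \<kappa> by simp
      have adm: "admissible ?\<delta> ?\<eta> P (property_search P) ?\<Gamma> \<kappa> 1 \<kappa>"
        by (rule admissible_low_proj[OF True assms(2) k \<eta>1 assms(3) \<kappa>])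
      have "1 + (\<kappa> - 1) * s\<^sup>2 \<le> (\<Prod>t=1..T. (1 + m t)\<^sup>2)"
        unfolding m_def s_def by (rule T[rule_format, OF adm])
      moreover have "0 \<le> m t \<and> m t \<le> (\<kappa> - 1) / sqrt \<kappa> * (25 / 23 * a t)" if t: "t \<in> {1..T}" for t
      proof
        have "0 \<le> (\<kappa> - 1) / sqrt \<kappa> *
          opnorm (ladder_proj ?\<Gamma> \<kappa> (0 + 1) ** reach_proj ?\<delta> t ** phase_oracle undefined undefined
                ** reach_proj ?\<delta> (t - 1) ** ladder_proj ?\<Gamma> \<kappa> 0)"
          using c0 opnorm_nonneg by (intro mult_nonneg_nonneg) auto
        also have "\<dots> \<le> m t"
          unfolding m_def by (rule Max_ge) (auto intro!: image_eqI[of _ _ "(0, undefined, undefined)"])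
        finally show "0 \<le> m t" .
        have bound: "(\<kappa> - 1) / sqrt \<kappa> *
            opnorm (ladder_proj ?\<Gamma> \<kappa> (Suc 0) ** reach_proj ?\<delta> t ** phase_oracle x y
                ** reach_proj ?\<delta> (t - 1) ** ladder_proj ?\<Gamma> \<kappa> 0)
            \<le> (\<kappa> - 1) / sqrt \<kappa> * (25 / 23 * a t)" for x y
        proof (rule mult_left_mono)
          show "opnorm (ladder_proj ?\<Gamma> \<kappa> (Suc 0) ** reach_proj ?\<delta> t ** phase_oracle x y
                ** reach_proj ?\<delta> (t - 1) ** ladder_proj ?\<Gamma> \<kappa> 0) \<le> 25 / 23 * a t"
            unfolding la reach_proj_uniform
            using transition_bound[OF True, of t x y] t comp_term_ge[of t P x y] by (simp add: a_def)
        qed (use c0 in simp)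
        then show "m t \<le> (\<kappa> - 1) / sqrt \<kappa> * (25 / 23 * a t)"
          unfolding m_def by (intro Max.boundedI) auto
      qed
      ultimately have "s \<le> 3 * (\<Sum>t=1..T. a t)" using potential_growth[OF s0 \<kappa>_def] by blast
      then have "2 * s \<le> real 6 * (\<Sum>t=1..T. a t)" by simp
      also have "\<dots> \<le> (\<Sum>t=1..6 * T. a t)"
        unfolding a_def by (rule sum_block_le) (rule comp_term_mono)
      finally show ?thesis using s2 by simp
    next
      case False
      \<comment> \<open>For \<open>T = 0\<close> there would be no summands between
        \<open>Suc T\<close> and \<open>6 * T\<close>. The empty database lacks the property, so the
        idle norm would be 0.\<close>
      have "T \<noteq> 0"
      proof
        assume "T = 0"
        have "p \<noteq> []" if "p \<in> P" for p using assms(2)[OF that] k by auto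
        then have "db_le T \<inter> db_prop P = {}"
          using empty_database_unmarked[of P] \<open>T = 0\<close> by (auto simp: db_le_def)
        then have "?idle = opnorm (basis_proj {} ** (Comp ** dagger Comp) ** basis_proj (db_le T - db_prop P))" by simp
        also have "\<dots> \<le> 0"
          by (rule opnorm_le) (simp add: vec_eq_iff matrix_vector_mul_assoc[symmetric] basis_proj_vec_nth)
        finally show False using False by simp
      qed
      then have T1: "1 \<le> real T" by simp
      have a: "1 / 5 \<le> a (Suc T)" using False idle_term_le[of T P] by (simp add: a_def)
      have "sqrt (1 - \<epsilon>) \<le> 1" using assms(4) by simp
      then have "sqrt (1 - \<epsilon>) - q \<le> 1" using q(1) by linarith
      \<comment> \<open>The range from \<open>Suc T\<close> to \<open>6 * T\<close> has
        \<open>5 * T\<close> summands, each at least 1/5.\<close>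
      also have "1 \<le> real (5 * T) * a (Suc T)" using mult_mono[of 5 "real (5 * T)" "1 / 5" "a (Suc T)"] T1 a by simp
      also have "\<dots> = (\<Sum>t=Suc T..6 * T. a (Suc T))" by simp
      also have "\<dots> \<le> (\<Sum>t=Suc T..6 * T. a t)"
        unfolding a_def by (intro sum_mono comp_term_mono) simp
      also have "\<dots> \<le> (\<Sum>t=1..6 * T. a t)"
        unfolding a_def by (intro sum_mono2) (auto simp: comp_term_nonneg)
      finally show ?thesis .
    qed
    then show ?thesis unfolding COMP_def a_def comp_term_def q_def by (intro Inf_lower) simp
  qed
  show ?thesis
  proof (cases "MLADV ?\<delta> \<epsilon> ?\<eta> P (property_search P)")
    case infinity
    then show ?thesis by (simp add: imult_infinity_right)
  next
    case (enat T)
    \<comment> \<open>A finite infimum in \<open>enat\<close> is attained, so the adversary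
      inequality holds at the bound itself.\<close>
    then have "enat T \<in> enat ` {T. \<forall>\<Gamma> \<kappa> l lam. admissible ?\<delta> ?\<eta> P (property_search P) \<Gamma> \<kappa> l lam \<longrightarrow>
     1 + (lam - 1) * (sqrt (1 - \<epsilon>) - sqrt ?\<eta>)\<^sup>2 \<le>
     (\<Prod>t=1..T. (1 + (MAX (i, x, y) \<in> {0..l - 1} \<times> UNIV \<times> UNIV.
        (\<kappa> - 1) / sqrt \<kappa> *
        opnorm (ladder_proj \<Gamma> \<kappa> (i + 1) ** reach_proj ?\<delta> t ** phase_oracle x y
                ** reach_proj ?\<delta> (t - 1) ** ladder_proj \<Gamma> \<kappa> i)))\<^sup>2)}"
      unfolding MLADV_def Inf_enat_def by (metis (lifting) LeastI enat.distinct(1) ex_in_conv)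
    then have "COMP \<epsilon> k P \<le> enat (6 * T)" using main[of T] by blast
    also have "enat (6 * T) = 6 * enat T" by (metis numeral_eq_enat times_enat_simps(1))
    finally show ?thesis using enat by simp
  qed
qed

end
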